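(* Let $G$ be a polycyclic-by-finite group with polynomial subgroup growth such that the Dirichlet series $\Delta_G$ has integer coefficients. Suppose that $G$ has Hirsch length at least $2$. Let $\mathcal{A}$ be a finite alphabet and let $\sigma(G)$ be the full shift of $G$ on $\mathcal{A}^G$. Then the dynamical zeta function $\zeta_{\sigma(G)}$ has a natural boundary at the circle of convergence $|z|=|\mathcal{A}|^{-1}$.
   Context: For a finitely generated group $G$, $\mathcal{L}_G$ denotes the set of finite index subgroups of $G$, $[L]=[G:L]$ for $L\in\mathcal{L}_G$, and $a_G(n)$ is the (finite) number of subgroups of index $n$. $G$ has polynomial subgroup growth (is a PSG group) if $a_G(n)$ grows at most polynomially in $n$. If $G$ is polycyclic-by-finite, there is a finite index subgroup $G_m\leqslant G$ with a subnormal series $\{1\}=G_0\lhd G_1\lhd\dots\lhd G_m$ with each $G_k/G_{k-1}$ infinite cyclic; the number $m$ is an invariant of $G$, called its Hirsch length. For a $G$-action $\alpha$ on a set $X$ and $L\in\mathcal{L}_G$, $\mathsf{F}_\alpha(L)$ is the cardinality of $\{x\in X: gx=x\text{ for all }g\in L\}$. When all $\mathsf{F}_\alpha(L)$ are finite, the dynamical zeta function of $\alpha$ is the power series $\zeta_\alpha(z)=\exp\sum_{L\in\mathcal{L}_G}\frac{\mathsf{F}_\alpha(L)}{[L]}z^{[L]}$. The zeta function of $G$ is the formal Dirichlet series $\zeta_G(z)=\sum_{n\geqslant 1}a_G(n)n^{-z}$ and, with $\zeta$ the Riemann zeta function, $\Delta_G$ is the formal Dirichlet series $\Delta_G(z)=\zeta_G(z+1)/\zeta(z+1)=\sum_{n\geqslant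 1}b_G(n)n^{-z}$, with $b_G(n)\in\mathbb{Q}$. An alphabet is a nonempty set. The full shift $\sigma(G)$ of $G$ on $\mathcal{A}^G$ is the action given by $(hx)_g=x_{h^{-1}g}$ for $x=(x_g)_{g\in G}\in\mathcal{A}^G$ and $h\in G$. A power series with radius of convergence $R\in(0,\infty)$ has the circle $|z|=R$ as a natural boundary if the function it defines on $|z|<R$ cannot be continued analytically across any point of that circle. *)

theory Defs
  imports
    "HOL-Algebra.Elementary_Groups"
    "HOL-Algebra.Group_Action"
    "HOL-Complex_Analysis.Complex_Analysis"
    "HOL-Library.Landau_Symbols"
begin

section \<open>Finite index subgroups and subgroup growth\<close>

definition subgroup_index :: "('g, 'm) monoid_scheme \<Rightarrow> 'g set \<Rightarrow> nat" where
  "subgroup_index G L = card (rcosets\<^bsub>G\<^esub> L)"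

definition finite_index_subgroups :: "('g, 'm) monoid_scheme \<Rightarrow> 'g set set" where
  "finite_index_subgroups G = {L. subgroup L G \<and> finite (rcosets\<^bsub>G\<^esub> L)}"

text \<open>
  The set below is finite whenever \<open>G\<close> is finitely generated, in particular whenever \<open>G\<close> is
  polycyclic-by-finite.  It is empty for \<open>n = 0\<close>.
\<close>

definition subgroups_of_index :: "('g, 'm) monoid_scheme \<Rightarrow> nat \<Rightarrow> 'g set set" where
  "subgroups_of_index G n = {L \<in> finite_index_subgroups G. subgroup_index G L = n}"

definition subgroup_count :: "('g, 'm) monoid_scheme \<Rightarrow> nat \<Rightarrow> nat" where
  "subgroup_count G n = card (subgroups_of_index G n)"

definition polynomial_subgroup_growth :: "('g, 'm) monoid_scheme \<Rightarrow> bool" where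
  "polynomial_subgroup_growth G \<longleftrightarrow>
     (\<exists>k::nat. (\<lambda>n. real (subgroup_count G n)) \<in> O(\<lambda>n. real n ^ k))"

section \<open>Polycyclic-by-finite groups and Hirsch length\<close>

text \<open>
  A subnormal series \<open>{1} = S 0 \<lhd> S 1 \<lhd> \<dots> \<lhd> S m = H\<close> of subgroups of \<open>G\<close>, all of whose
  factors satisfy \<open>P\<close>.
\<close>

definition subnormal_series ::
    "('g, 'm) monoid_scheme \<Rightarrow> ('g set monoid \<Rightarrow> bool) \<Rightarrow> 'g set \<Rightarrow> nat \<Rightarrow> (nat \<Rightarrow> 'g set) \<Rightarrow> bool"
  where
  "subnormal_series G P H m S \<longleftrightarrow>
     S 0 = {\<one>\<^bsub>G\<^esub>} \<and> S m = H \<and> (\<forall>k\<le>m. subgroup (S k) G) \<and>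
     (\<forall>k<m. S k \<lhd> G\<lparr>carrier := S (Suc k)\<rparr> \<and> P (G\<lparr>carrier := S (Suc k)\<rparr> Mod S k))"

definition infinite_cyclic_group :: "('g, 'm) monoid_scheme \<Rightarrow> bool" where
  "infinite_cyclic_group G \<longleftrightarrow> cyclic_group G \<and> infinite (carrier G)"

definition polycyclic_by_finite :: "('g, 'm) monoid_scheme \<Rightarrow> bool" where
  "polycyclic_by_finite G \<longleftrightarrow>
     (\<exists>N \<in> finite_index_subgroups G. N \<lhd> G \<and> (\<exists>m S. subnormal_series G cyclic_group N m S))"

text \<open>
  For polycyclic-by-finite \<open>G\<close> there is exactly one such \<open>m\<close>, the Hirsch length of \<open>G\<close>.
\<close>

definition has_hirsch_length :: "('g, 'm) monoid_scheme \<Rightarrow> nat \<Rightarrow> bool" where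
  "has_hirsch_length G m \<longleftrightarrow>
     (\<exists>H \<in> finite_index_subgroups G. \<exists>S. subnormal_series G infinite_cyclic_group H m S)"

section \<open>Formal Dirichlet series\<close>

text \<open>
  The formal Dirichlet series \<open>\<Sum>n\<ge>1. f n * n powr (-z)\<close> is represented by its coefficient function
  \<open>f\<close>; the value at index \<open>0\<close> is irrelevant.
\<close>

definition dirichlet_mult :: "(nat \<Rightarrow> rat) \<Rightarrow> (nat \<Rightarrow> rat) \<Rightarrow> nat \<Rightarrow> rat" where
  "dirichlet_mult f g n = (\<Sum>d | d dvd n. f d * g (n div d))"

text \<open>The quotient \<open>f / g\<close>, for \<open>g 1 \<noteq> 0\<close>; see \<open>dirichlet_mult_divide\<close> and
  \<open>dirichlet_divide_unique\<close>.\<close>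

fun dirichlet_divide :: "(nat \<Rightarrow> rat) \<Rightarrow> (nat \<Rightarrow> rat) \<Rightarrow> nat \<Rightarrow> rat" where
  "dirichlet_divide f g n =
     (f n - (\<Sum>d | d dvd n \<and> d < n. dirichlet_divide f g d * g (n div d))) / g 1"

declare dirichlet_divide.simps [simp del]

lemma dirichlet_mult_split:
  assumes "n > 0"
  shows "dirichlet_mult f g n = f n * g 1 + (\<Sum>d | d dvd n \<and> d < n. f d * g (n div d))"
proof -
  have "{d. d dvd n} = insert n {d. d dvd n \<and> d < n}"
    using assms by (auto dest: dvd_imp_le)
  then show ?thesis
    using assms by (simp add: dirichlet_mult_def)
qed

lemma dirichlet_mult_divide:
  assumes "g 1 \<noteq> 0" "n > 0"
  shows "dirichlet_mult (dirichlet_divide f g) g n = f n"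
  using assms by (simp add: dirichlet_mult_split dirichlet_divide.simps [of f g n])

lemma dirichlet_divide_unique:
  assumes "g 1 \<noteq> 0" and "\<And>n. n > 0 \<Longrightarrow> dirichlet_mult h g n = f n" and "n > 0"
  shows "h n = dirichlet_divide f g n"
  using assms(3)
proof (induction n rule: less_induct)
  case (less n)
  have "(\<Sum>d | d dvd n \<and> d < n. h d * g (n div d)) =
        (\<Sum>d | d dvd n \<and> d < n. dirichlet_divide f g d * g (n div d))"
    by (intro sum.cong) (use less in \<open>auto intro!: Nat.gr0I\<close>)
  then show ?case
    using assms(1) assms(2) [of n] less.prems
    by (simp add: dirichlet_mult_split dirichlet_divide.simps [of f g n] field_simps)
qed

text \<open>Coefficients of \<open>D(z + 1)\<close> for a formal Dirichlet series \<open>D(z)\<close>.\<close>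

definition dirichlet_shift :: "(nat \<Rightarrow> rat) \<Rightarrow> nat \<Rightarrow> rat" where
  "dirichlet_shift f n = f n / of_nat n"

definition riemann_zeta_coeff :: "nat \<Rightarrow> rat" where
  "riemann_zeta_coeff n = 1"

definition group_zeta_coeff :: "('g, 'm) monoid_scheme \<Rightarrow> nat \<Rightarrow> rat" where
  "group_zeta_coeff G n = of_nat (subgroup_count G n)"

text \<open>\<open>\<Delta>\<^sub>G(z) = \<zeta>\<^sub>G(z + 1) / \<zeta>(z + 1)\<close>\<close>

definition Delta_coeff :: "('g, 'm) monoid_scheme \<Rightarrow> nat \<Rightarrow> rat" where
  "Delta_coeff G =
     dirichlet_divide (dirichlet_shift (group_zeta_coeff G)) (dirichlet_shift riemann_zeta_coeff)"

section \<open>Dynamical zeta functions and the full shift\<close>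

definition fixed_point_count :: "'x set \<Rightarrow> ('g \<Rightarrow> 'x \<Rightarrow> 'x) \<Rightarrow> 'g set \<Rightarrow> nat" where
  "fixed_point_count X \<alpha> L = card {x \<in> X. \<forall>g\<in>L. \<alpha> g x = x}"

text \<open>
  Meaningful for finitely generated \<open>G\<close> if every finite index subgroup has finitely many fixed
  points.  The sum over \<open>finite_index_subgroups G\<close> is grouped according to the exponent of the
  variable.
\<close>

definition dynamical_zeta ::
    "('g, 'm) monoid_scheme \<Rightarrow> 'x set \<Rightarrow> ('g \<Rightarrow> 'x \<Rightarrow> 'x) \<Rightarrow> complex fps" where
  "dynamical_zeta G X \<alpha> =
     fps_exp 1 oo
       Abs_fps (\<lambda>n. \<Sum>L\<in>subgroups_of_index G n.
         of_nat (fixed_point_count X \<alpha> L) / of_nat (subgroup_index G L))"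

definition configurations :: "('g, 'm) monoid_scheme \<Rightarrow> 'a set \<Rightarrow> ('g \<Rightarrow> 'a) set" where
  "configurations G A = carrier G \<rightarrow>\<^sub>E A"

definition full_shift ::
    "('g, 'm) monoid_scheme \<Rightarrow> 'a set \<Rightarrow> 'g \<Rightarrow> ('g \<Rightarrow> 'a) \<Rightarrow> 'g \<Rightarrow> 'a" where
  "full_shift G A h = (\<lambda>x\<in>configurations G A. \<lambda>g\<in>carrier G. x (inv\<^bsub>G\<^esub> h \<otimes>\<^bsub>G\<^esub> g))"

lemma (in group) full_shift_group_action:
  "group_action G (configurations G A) (full_shift G A)"
proof -
  let ?X = "configurations G A"
  have mem: "full_shift G A h x \<in> ?X" if "h \<in> carrier G" "x \<in> ?X" for h x
    using that by (auto simp: full_shift_def configurations_def)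
  have mult: "full_shift G A (h \<otimes> k) x = full_shift G A h (full_shift G A k x)"
    if "h \<in> carrier G" "k \<in> carrier G" "x \<in> ?X" for h k x
    using that mem [OF that(2,3)]
    by (auto simp: full_shift_def inv_mult_group m_assoc intro!: restrict_ext)
  have one: "full_shift G A \<one> x = x" if "x \<in> ?X" for x
    using that by (auto simp: full_shift_def configurations_def PiE_iff extensional_def)
  have inv1: "full_shift G A (inv h) (full_shift G A h x) = x"
    and inv2: "full_shift G A h (full_shift G A (inv h) x) = x"
    if "h \<in> carrier G" "x \<in> ?X" for h x
    using that mult [of "inv h" h x] mult [of h "inv h" x] one by auto
  have bij: "full_shift G A h \<in> Bij ?X" if "h \<in> carrier G" for h
  proof -
    have "bij_betw (full_shift G A h) ?X ?X"
      by (rule bij_betw_byWitness [where f' = "full_shift G A (inv h)"])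
         (use that mem inv1 inv2 in auto)
    then show ?thesis
      by (simp add: Bij_def full_shift_def)
  qed
  have "full_shift G A (h \<otimes> k) = compose ?X (full_shift G A h) (full_shift G A k)"
    if "h \<in> carrier G" "k \<in> carrier G" for h k
  proof
    fix x
    show "full_shift G A (h \<otimes> k) x = compose ?X (full_shift G A h) (full_shift G A k) x"
      using mult [OF that, of x] by (cases "x \<in> ?X") (auto simp: compose_def full_shift_def)
  qed
  with bij have "full_shift G A \<in> hom G (BijGroup ?X)"
    by (auto simp: hom_def BijGroup_def)
  then show ?thesis
    by (simp add: group_action_def group_hom_def group_hom_axioms_def group_BijGroup is_group)
qed

section \<open>Natural boundaries\<close>

definition continues_analytically_across :: "complex fps \<Rightarrow> real \<Rightarrow> complex \<Rightarrow> bool" where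
  "continues_analytically_across F R w \<longleftrightarrow>
     (\<exists>e>0. \<exists>f. f holomorphic_on ball w e \<and> (\<forall>z \<in> ball w e \<inter> ball 0 R. f z = eval_fps F z))"

definition has_natural_boundary :: "complex fps \<Rightarrow> real \<Rightarrow> bool" where
  "has_natural_boundary F R \<longleftrightarrow>
     R > 0 \<and> fps_conv_radius F = ereal R \<and>
     (\<forall>w \<in> sphere 0 R. \<not> continues_analytically_across F R w)"

end

theory Submission
  imports Defs "HOL-Real_Asymp.Real_Asymp"
begin

text \<open>
  With \<open>q = |A|\<close>, a subgroup \<open>L\<close> of finite index has \<open>q ^ [L]\<close> fixed points, so the
  dynamical zeta function is \<open>F(q z)\<close> for \<open>F(z) = exp (\<Sum>n. a\<^sub>G(n) z ^ n / n)\<close>.  The definition of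
  \<open>\<Delta>\<^sub>G\<close> amounts to \<open>a\<^sub>G(n) = \<Sum>d | d dvd n. d b\<^sub>G(d)\<close>, that is,
  \<open>F(z) = \<Prod>d. (1 - z ^ d) powr (- b\<^sub>G(d))\<close>, which has integer coefficients; it converges and has no
  zeros in the unit disc.  If \<open>F\<close> continued analytically across a point of the unit circle, it would
  be rational by the theorem of Polya and Carlson, with zeros and poles outside the open disc,
  and the coefficients \<open>a\<^sub>G(n)\<close> of \<open>z F'(z) / F(z)\<close> would be bounded.  But \<open>G\<close> has a subgroup \<open>H\<close> of
  finite index with an infinite cyclic quotient \<open>H / K\<close> whose kernel \<open>K\<close> again maps onto the
  integers.  If \<open>N \<lhd> H\<close> has finite index \<open>k\<close> in \<open>K\<close>, then \<open>H / N\<close> has \<open>k\<close> complements of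
  \<open>K / N\<close>, all of index \<open>k\<close> in \<open>H\<close>; since \<open>k\<close> may be arbitrarily large, \<open>a\<^sub>G\<close> is unbounded.

  The theorem of Polya and Carlson is proved without Hankel determinants: the pigeonhole principle
  yields a short integer relation annihilating the first coefficients, and a contour on which a
  monic polynomial is small shows that it annihilates all of them.
\<close>

section \<open>The Polya--Carlson theorem\<close>

text \<open>The unit circle has capacity exactly 1, so integer coefficients and convergence in the
  disc alone do not force rationality. Continuation across one arc lets the contour move outwards
  there, which in the variable \<open>x = 1 / z\<close> lowers the capacity below 1: some monic
  \<open>P\<close> satisfies \<open>|P| \<le> exp (- l * degree P)\<close> on the contour, while the
  rest of it is pulled inwards so little that \<open>|x| \<le> exp (l / 8)\<close>. The constants
  balance this gain against two losses. With growth rate \<open>l / 12\<close>, coefficients of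
  index below \<open>3 * J\<close> are of size \<open>exp (l * J / 4)\<close> up to a constant, and
  so is, up to a factor linear in \<open>J\<close>, the pigeonhole relation; powers of
  \<open>x\<close> below \<open>2 * J\<close> cost another \<open>exp (l * J / 4)\<close>. Against
  the saving \<open>exp (- l * j)\<close> with \<open>j \<ge> J\<close>, the product tends to 0. The
  integers, of Hirsch length 1, have all counts equal to 1 and \<open>F(z) = 1 / (1 - z)\<close>;
  the unboundedness of the counts is where the Hirsch length enters.\<close>

text \<open>Siegel's lemma by pigeonhole: with twice as many unknowns as equations, the bound on the
  solution stays linear in \<open>B\<close>.\<close>

lemma integer_relations_exist:
  fixes c :: "nat \<Rightarrow> int" and J :: nat and B :: int
  assumes J: "J \<ge> 1" and B: "B \<ge> 1" and c: "\<And>n. n < 3 * J \<Longrightarrow> \<bar>c n\<bar> \<le> B"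
  shows "\<exists>q :: nat \<Rightarrow> int. (\<exists>i<2*J. q i \<noteq> 0) \<and> (\<forall>i. \<bar>q i\<bar> \<le> 4 * int J * B) \<and>
           (\<forall>j<J. (\<Sum>i<2*J. q i * c (i + j)) = 0)"
proof -
  \<comment> \<open>This choice makes \<open>2 * Y = X ^ 2\<close>, hence
    \<open>2 * Y + 1 < (X + 1) ^ 2\<close>: the box \<open>D\<close> of candidates outnumbers the
    box \<open>T\<close> of values.\<close>
  define X where "X = 4 * int J * B"
  define Y where "Y = 2 * int J * X * B"
  have X0: "X \<ge> 0" "Y \<ge> 0" using B by (auto simp: X_def Y_def)
  define D where "D = ({..<2*J} \<rightarrow>\<^sub>E {0..X})"
  define T where "T = ({..<J} \<rightarrow>\<^sub>E {-Y..Y})"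
  define h where "h = (\<lambda>q :: nat \<Rightarrow> int. \<lambda>j\<in>{..<J}. (\<Sum>i<2*J. q i * c (i + j)))"
  have hT: "h ` D \<subseteq> T"
  proof -
    have "\<bar>\<Sum>i<2*J. q i * c (i + j)\<bar> \<le> Y" if "q \<in> D" "j < J" for q j
    proof -
      have "\<bar>\<Sum>i<2*J. q i * c (i + j)\<bar> \<le> (\<Sum>i<2*J. \<bar>q i * c (i + j)\<bar>)" by (rule sum_abs)
      also have "\<dots> \<le> (\<Sum>i<2*J. X * B)"
      proof (rule sum_mono)
        fix i assume i: "i \<in> {..<2*J}"
        have "0 \<le> q i" "q i \<le> X" using that(1) i by (auto simp: D_def dest!: PiE_mem)
        moreover have "\<bar>c (i + j)\<bar> \<le> B" using i that(2) by (intro c) auto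
        ultimately show "\<bar>q i * c (i + j)\<bar> \<le> X * B"
          unfolding abs_mult using X0 by (intro mult_mono) auto
      qed
      also have "\<dots> = Y" by (simp add: Y_def)
      finally show ?thesis .
    qed
    then show ?thesis by (fastforce simp: T_def h_def abs_le_iff)
  qed
  have "card T = nat (2 * Y + 1) ^ J"
    using X0 by (simp add: T_def card_PiE)
  also have "\<dots> < (nat (X + 1) ^ 2) ^ J"
  proof (rule power_strict_mono)
    have "2 * Y + 1 < (X + 1)^2"
      using B J by (simp add: X_def Y_def power2_eq_square algebra_simps)
    then show "nat (2 * Y + 1) < nat (X + 1) ^ 2"
      using X0 by (metis add_nonneg_nonneg nat_less_eq_zless nat_power_eq zero_less_one_class.zero_le_one zero_le_mult_iff zero_le_numeral)
  qed (use J in auto)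
  also have "\<dots> = card D"
    using X0 by (simp add: D_def card_PiE power_mult)
  finally have "card (h ` D) < card D"
    using card_mono[OF _ hT] by (simp add: T_def finite_PiE)
  then obtain q1 q2 where q: "q1 \<in> D" "q2 \<in> D" "q1 \<noteq> q2" "h q1 = h q2"
    using pigeonhole[of h D] by (auto simp: inj_on_def)
  define q where "q = (\<lambda>i. if i < 2*J then q1 i - q2 i else 0)"
  have "\<exists>i<2*J. q i \<noteq> 0"
  proof (rule ccontr)
    assume "\<not> ?thesis"
    then have "q1 = q2" using q(1,2) unfolding D_def by (intro PiE_ext) (auto simp: q_def)
    with q show False by simp
  qed
  moreover have "\<bar>q i\<bar> \<le> X" for i
  proof (cases "i < 2*J")
    case True
    then have "0 \<le> q1 i" "q1 i \<le> X" "0 \<le> q2 i" "q2 i \<le> X" using q(1,2) by (auto simp: D_def dest!: PiE_mem)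
    then show ?thesis using True by (auto simp: q_def)
  qed (use X0 in \<open>auto simp: q_def\<close>)
  moreover have "(\<Sum>i<2*J. q i * c (i + j)) = 0" if "j < J" for j
  proof -
    have "h q1 j = h q2 j" using q by simp
    then show ?thesis using that by (simp add: h_def q_def left_diff_distrib sum_subtractf)
  qed
  ultimately show ?thesis unfolding X_def by blast
qed

section \<open>Polynomials with prescribed real part on the unit circle\<close>

text \<open>On the circle \<open>|p|^2\<close> is a trigonometric polynomial. Conjugating its terms
  of negative frequency keeps all real parts and leaves a polynomial in \<open>z\<close>, whose
  value at 0 is the mean of \<open>|p|^2\<close>, that is, the sum of the squared
  coefficients.\<close>

lemma exists_poly_Re_eq_norm_square:
  fixes p :: "complex poly"
  shows "\<exists>q. poly q 0 = of_real (\<Sum>i\<le>degree p. (norm (coeff p i))\<^sup>2) \<and>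
           (\<forall>z. norm z = 1 \<longrightarrow> Re (poly q z) = (norm (poly p z))\<^sup>2)"
proof -
  define n where "n = degree p"
  define t where "t = (\<lambda>i j. if j \<le> i then monom (coeff p i * cnj (coeff p j)) (i - j)
                              else monom (cnj (coeff p i) * coeff p j) (j - i))"
  define q where "q = (\<Sum>i\<le>n. \<Sum>j\<le>n. t i j)"
  have Re_t: "Re (poly (t i j) z) = Re ((coeff p i * z ^ i) * cnj (coeff p j * z ^ j))" if "norm z = 1" for i j z
  proof -
    have zz: "z * cnj z = 1" using that complex_norm_square[of z] by simp
    show ?thesis
    proof (cases "j \<le> i")
      case True
      then obtain d where d: "i = j + d" using le_Suc_ex by blast
      have "(coeff p i * z ^ i) * cnj (coeff p j * z ^ j) = coeff p i * cnj (coeff p j) * z ^ d * (z * cnj z) ^ j"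
        by (simp add: d power_add power_mult_distrib algebra_simps)
      moreover have "poly (t i j) z = coeff p i * cnj (coeff p j) * z ^ d"
        by (simp add: t_def d poly_monom)
      ultimately show ?thesis by (simp only: zz power_one mult_1_right)
    next
      case False
      then obtain d where d: "j = i + d" using le_Suc_ex nat_le_linear by blast
      have "(coeff p i * z ^ i) * cnj (coeff p j * z ^ j) = cnj (cnj (coeff p i) * coeff p j * z ^ d) * (z * cnj z) ^ i"
        by (simp add: d power_add power_mult_distrib algebra_simps)
      moreover have "poly (t i j) z = cnj (coeff p i) * coeff p j * z ^ d"
        using False by (simp add: t_def d poly_monom)
      ultimately show ?thesis by (simp only: zz power_one mult_1_right cnj.simps)
    qed
  qed
  have "Re (poly q z) = (norm (poly p z))\<^sup>2" if "norm z = 1" for z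
  proof -
    have "Re (poly q z) = (\<Sum>i\<le>n. \<Sum>j\<le>n. Re ((coeff p i * z ^ i) * cnj (coeff p j * z ^ j)))"
      using that Re_t by (simp add: q_def poly_sum)
    also have "\<dots> = Re (poly p z * cnj (poly p z))"
      unfolding poly_altdef n_def by (simp only: sum_product cnj_sum Re_sum)
    also have "\<dots> = (norm (poly p z))\<^sup>2" by (metis Re_complex_of_real complex_norm_square)
    finally show ?thesis .
  qed
  moreover have "poly q 0 = of_real (\<Sum>i\<le>n. (norm (coeff p i))\<^sup>2)"
  proof -
    have "poly (t i j) 0 = (if j = i then of_real ((norm (coeff p i))\<^sup>2) else 0)" for i j
      by (auto simp: t_def poly_monom complex_norm_square[symmetric] simp del: of_real_power)
    then show ?thesis by (simp add: q_def poly_sum)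
  qed
  ultimately show ?thesis unfolding n_def by blast
qed

text \<open>The source is \<open>p = ((1 + z / w) / 2) ^ M\<close>, whose modulus peaks at
  \<open>w\<close>. The mean of \<open>|p|^2\<close> is at least \<open>1 / (M + 1)\<close> by
  Cauchy--Schwarz, since \<open>p\<close> has \<open>M + 1\<close> coefficients and value 1 at
  \<open>w\<close>. So the mean decays at most polynomially in \<open>M\<close>, the values away
  from \<open>w\<close> exponentially.\<close>

lemma exists_poly_Re_peak:
  fixes w :: complex
  assumes w: "norm w = 1"
  shows "\<exists>q. (\<exists>a::real. poly q 0 = of_real a \<and> a \<ge> 1 / real (M + 1)) \<and>
           (\<forall>z. norm z = 1 \<longrightarrow> Re (poly q z) = (1 - (norm (z - w))\<^sup>2 / 4) ^ M)"
proof -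
  define p where "p = [: 1/2, 1 / (2 * w) :] ^ M"
  obtain q where q0: "poly q 0 = of_real (\<Sum>i\<le>degree p. (norm (coeff p i))\<^sup>2)"
     and q: "\<And>z. norm z = 1 \<Longrightarrow> Re (poly q z) = (norm (poly p z))\<^sup>2"
    using exists_poly_Re_eq_norm_square[of p] by blast
  have w0: "w \<noteq> 0" using w by auto
  have "degree p = M" unfolding p_def using w0 by (simp add: degree_power_eq)
  have "poly p w = 1" using w0 by (simp add: p_def)
  have "1 = norm (\<Sum>i\<le>M. coeff p i * w ^ i)"
    using \<open>poly p w = 1\<close> \<open>degree p = M\<close> by (simp add: poly_altdef)
  also have "\<dots> \<le> (\<Sum>i\<le>M. norm (coeff p i))"
    by (rule order_trans[OF norm_sum]) (simp add: norm_mult norm_power w)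
  finally have 1: "1 \<le> (\<Sum>i\<le>M. norm (coeff p i))" .
  have "1 \<le> (\<Sum>i\<le>M. norm (coeff p i))\<^sup>2" using 1 by (simp add: one_le_power)
  also have "\<dots> \<le> real (M + 1) * (\<Sum>i\<le>M. (norm (coeff p i))\<^sup>2)"
    using sum_squared_le_sum_of_squares[of "\<lambda>i. norm (coeff p i)" "{..M}"] by (simp add: mult.commute)
  finally have "(\<Sum>i\<le>M. (norm (coeff p i))\<^sup>2) \<ge> 1 / real (M + 1)"
    by (simp add: field_simps)
  moreover have "(norm (poly p z))\<^sup>2 = (1 - (norm (z - w))\<^sup>2 / 4) ^ M" if "norm z = 1" for z
  proof -
    have "(norm (1/2 + z / (2 * w)))\<^sup>2 = (norm (w + z))\<^sup>2 / 4"
    proof -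
      have "1/2 + z / (2 * w) = (w + z) / (2 * w)" using w0 by (simp add: field_simps)
      then show ?thesis by (simp add: norm_divide norm_mult w power_divide)
    qed
    also have "\<dots> = 1 - (norm (z - w))\<^sup>2 / 4"
    proof -
      have "(norm (w + z))\<^sup>2 + (norm (z - w))\<^sup>2 = 2 * (norm w)\<^sup>2 + 2 * (norm z)\<^sup>2"
        unfolding cmod_power2 by (simp add: power2_eq_square algebra_simps)
      then show ?thesis using w that by simp
    qed
    finally have "(norm (1/2 + z / (2 * w)))\<^sup>2 = 1 - (norm (z - w))\<^sup>2 / 4" .
    then show ?thesis
      by (simp add: p_def norm_power mult.commute[of w] flip: power_mult)
         (metis mult.commute power_mult)
  qed
  ultimately show ?thesis using q q0 unfolding \<open>degree p = M\<close>
    by (intro exI[of _ q] conjI exI[of _ "\<Sum>i\<le>M. (norm (coeff p i))\<^sup>2"]) auto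
qed

text \<open>A bound for \<open>ln |1 + u|\<close> with exact linear term; for \<open>u\<close> a
  small multiple of a fixed polynomial the quadratic term becomes negligible.\<close>

lemma norm_one_plus_le_exp: "norm (1 + u) \<le> exp (Re u + (norm u)\<^sup>2 / 2)" for u :: complex
proof -
  have "(norm (1 + u))\<^sup>2 = 1 + (2 * Re u + (norm u)\<^sup>2)"
    unfolding cmod_power2 by (simp add: power2_eq_square algebra_simps)
  also have "\<dots> \<le> exp (2 * Re u + (norm u)\<^sup>2)" by (rule exp_ge_add_one_self)
  also have "\<dots> = (exp (Re u + (norm u)\<^sup>2 / 2))\<^sup>2" by (simp add: power2_eq_square flip: exp_add)
  finally show ?thesis by (rule power2_le_imp_le) simp
qed

text \<open>Subtract its mean \<open>a\<close> from the peak: away from \<open>w\<close> the peak is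
  at most \<open>b ^ M\<close>, which drops below \<open>a\<close> for large \<open>M\<close>. The
  vanishing at 0 later makes \<open>P\<close> monic.\<close>

lemma exists_poly_negative_off_arc:
  fixes w :: complex
  assumes w: "norm w = 1" and \<delta>: "0 < \<delta>" "\<delta> \<le> 1"
  shows "\<exists>g \<kappa>. \<kappa> > 0 \<and> poly g 0 = 0 \<and> (\<forall>z. norm z = 1 \<longrightarrow> Re (poly g z) \<le> 1) \<and>
           (\<forall>z. norm z = 1 \<longrightarrow> norm (z - w) \<ge> \<delta> \<longrightarrow> Re (poly g z) \<le> - 4 * \<kappa>)"
proof -
  define b where "b = 1 - \<delta>\<^sup>2 / 4"
  have d2: "0 < \<delta>\<^sup>2" "\<delta>\<^sup>2 \<le> 1" using \<delta> by (auto simp: power_le_one)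
  have b: "0 < b" "b < 1" using d2 by (auto simp: b_def)
  have "(\<lambda>M. real (M + 1) * b ^ M) \<longlonglongrightarrow> 0" using b by real_asymp
  then have "eventually (\<lambda>M. real (M + 1) * b ^ M < 1) sequentially" by (rule order_tendstoD) simp
  then obtain M where M: "real (M + 1) * b ^ M < 1" by (auto simp: eventually_sequentially)
  obtain q a where q: "poly q 0 = of_real a" "a \<ge> 1 / real (M + 1)"
     "\<And>z. norm z = 1 \<Longrightarrow> Re (poly q z) = (1 - (norm (z - w))\<^sup>2 / 4) ^ M"
    using exists_poly_Re_peak[OF w, of M] by blast
  have "b ^ M < 1 / real (M + 1)" using M by (simp add: field_simps)
  then have ba: "b ^ M < a" using q(2) by linarith
  have nn: "norm (z - w) \<le> 2" if "norm z = 1" for z using norm_triangle_ineq4[of z w] that w by simp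
  have nn2: "0 \<le> 1 - (norm (z - w))\<^sup>2 / 4" if "norm z = 1" for z
    using power_mono[OF nn[OF that], of 2] by simp
  have a0: "a > 0" using q(2) by (smt (verit) zero_less_divide_1_iff of_nat_0_less_iff zero_less_Suc Suc_eq_plus1)
  show ?thesis
  proof (intro exI[of _ "q - [:of_real a:]"] exI[of _ "(a - b ^ M) / 4"] conjI allI impI)
    fix z :: complex assume z: "norm z = 1"
    have "(1 - (norm (z - w))\<^sup>2 / 4) ^ M \<le> 1" using nn2[OF z] by (intro power_le_one) auto
    then show "Re (poly (q - [:of_real a:]) z) \<le> 1" using q(3)[OF z] a0 by simp
    assume "norm (z - w) \<ge> \<delta>"
    then have "\<delta>\<^sup>2 \<le> (norm (z - w))\<^sup>2" using \<delta> by (intro power_mono) auto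
    then have "(1 - (norm (z - w))\<^sup>2 / 4) ^ M \<le> b ^ M"
      using nn2[OF z] unfolding b_def by (intro power_mono) auto
    then show "Re (poly (q - [:of_real a:]) z) \<le> - 4 * ((a - b ^ M) / 4)" using q(3)[OF z] by simp
  qed (use ba q in auto)
qed

lemma exists_poly_above_on_arc:
  fixes w :: complex
  assumes w: "norm w = 1" and \<delta>: "0 < \<delta>" "\<delta> \<le> 1 / 4" and \<tau>: "\<tau> > 0"
  shows "\<exists>G. (\<forall>z. norm z = 1 \<longrightarrow> Re (poly G z) \<ge> - \<tau>) \<and>
           (\<forall>z. norm z = 1 \<longrightarrow> norm (z - w) \<le> \<delta> \<longrightarrow> Re (poly G z) \<ge> K) \<and>
           (\<forall>z. norm z = 1 \<longrightarrow> norm (z - w) \<ge> 2 * \<delta> \<longrightarrow> Re (poly G z) < 0)"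
proof -
  \<comment> \<open>\<open>b\<close> and \<open>c\<close> are the bases of the peak at distance
    \<open>\<delta>\<close> and \<open>2 * \<delta>\<close> from \<open>w\<close>. As
    \<open>c < b\<close>, a suitable multiple of a high power is large up to distance
    \<open>\<delta>\<close> and below \<open>\<tau>\<close> beyond \<open>2 * \<delta>\<close>;
    subtracting \<open>\<tau>\<close> gives the required signs.\<close>
  define b where "b = 1 - \<delta>\<^sup>2 / 4"
  define c where "c = 1 - \<delta>\<^sup>2"
  have d2: "0 < \<delta>\<^sup>2" "\<delta>\<^sup>2 \<le> 1/16" using \<delta> power_mono[of \<delta> "1/4" 2] by (auto simp: power2_eq_square)
  have bc: "0 < c" "c < b" "0 < b" using d2 by (auto simp: b_def c_def)
  define L where "L = \<bar>K\<bar> + \<tau>"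
  have L: "L > 0" using \<tau> by (simp add: L_def)
  have "(\<lambda>M. L * (c / b) ^ M) \<longlonglongrightarrow> L * 0"
    using bc by (intro tendsto_mult tendsto_const LIMSEQ_power_zero) auto
  then have "eventually (\<lambda>M. L * (c / b) ^ M < \<tau>) sequentially" using \<tau> by (intro order_tendstoD) auto
  then obtain M where M: "L * (c / b) ^ M < \<tau>" by (auto simp: eventually_sequentially)
  obtain q where q: "\<And>z. norm z = 1 \<Longrightarrow> Re (poly q z) = (1 - (norm (z - w))\<^sup>2 / 4) ^ M"
    using exists_poly_Re_peak[OF w, of M] by blast
  define C where "C = L / b ^ M"
  have C: "C > 0" using L bc by (simp add: C_def)
  have nn: "norm (z - w) \<le> 2" if "norm z = 1" for z using norm_triangle_ineq4[of z w] that w by simp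
  have nn2: "0 \<le> 1 - (norm (z - w))\<^sup>2 / 4" if "norm z = 1" for z
    using power_mono[OF nn[OF that], of 2] by simp
  have ReG: "Re (poly (smult (of_real C) q - [:of_real \<tau>:]) z) = C * (1 - (norm (z - w))\<^sup>2 / 4) ^ M - \<tau>"
    if "norm z = 1" for z using q[OF that] by simp
  show ?thesis
  proof (intro exI[of _ "smult (of_real C) q - [:of_real \<tau>:]"] conjI allI impI)
    fix z :: complex assume z: "norm z = 1"
    show "- \<tau> \<le> Re (poly (smult (of_real C) q - [:of_real \<tau>:]) z)"
      using C nn2[OF z] ReG[OF z] by simp
    { assume "norm (z - w) \<le> \<delta>"
      then have "(norm (z - w))\<^sup>2 \<le> \<delta>\<^sup>2" by (intro power_mono) auto
      then have "b ^ M \<le> (1 - (norm (z - w))\<^sup>2 / 4) ^ M"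
        using bc unfolding b_def by (intro power_mono) auto
      then have "C * b ^ M \<le> C * (1 - (norm (z - w))\<^sup>2 / 4) ^ M" using C by simp
      moreover have "C * b ^ M = L" using bc by (simp add: C_def)
      ultimately show "K \<le> Re (poly (smult (of_real C) q - [:of_real \<tau>:]) z)"
        unfolding ReG[OF z] by (simp add: L_def) }
    { assume "2 * \<delta> \<le> norm (z - w)"
      then have "(2*\<delta>)\<^sup>2 \<le> (norm (z - w))\<^sup>2" using \<delta> by (intro power_mono) auto
      then have "(1 - (norm (z - w))\<^sup>2 / 4) ^ M \<le> c ^ M"
        using nn2[OF z] unfolding c_def by (intro power_mono) (auto simp: power_mult_distrib)
      then have "C * (1 - (norm (z - w))\<^sup>2 / 4) ^ M \<le> C * c ^ M" using C by simp
      also have "\<dots> = L * (c / b) ^ M" by (simp add: C_def power_divide)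
      also have "\<dots> < \<tau>" by (rule M)
      finally show "Re (poly (smult (of_real C) q - [:of_real \<tau>:]) z) < 0"
        unfolding ReG[OF z] by simp }
  qed
qed

text \<open>
  The curve \<open>z \<mapsto> z * exp (poly \<psi> z)\<close>, \<open>|z| = 1\<close>, leaves the unit disc only near \<open>w\<close> and is so
  chosen that its image under inversion has capacity less than \<open>1\<close>, as witnessed by \<open>P\<close>.
\<close>

lemma exists_deformed_circle:
  fixes w :: complex
  assumes w: "norm w = 1" and e: "0 < e"
  shows "\<exists>P \<psi> l. degree P > 0 \<and> lead_coeff P = 1 \<and> l > 0 \<and>
     (\<forall>z. norm z \<le> 1 \<longrightarrow> z * exp (poly \<psi> z) \<in> ball 0 1 \<union> ball w e) \<and>
     (\<forall>z. norm z = 1 \<longrightarrow> norm (poly P (1 / (z * exp (poly \<psi> z)))) \<le> exp (- l * real (degree P))) \<and>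
     (\<forall>z. norm z = 1 \<longrightarrow> norm (1 / (z * exp (poly \<psi> z))) \<le> exp (l / 8))"
proof -
  \<comment> \<open>Points within \<open>2 * \<delta>\<close> of \<open>w\<close> will be moved by
    less than \<open>2 * \<delta>\<close>, so they stay within
    \<open>4 * \<delta> \<le> e\<close>.\<close>
  define \<delta> where "\<delta> = min e 1 / 4"
  have \<delta>: "0 < \<delta>" "\<delta> \<le> 1/4" "4 * \<delta> \<le> e" using e by (auto simp: \<delta>_def)
  obtain g \<kappa> where \<kappa>: "\<kappa> > 0" and g0: "poly g 0 = 0"
     and g1: "\<And>z. norm z = 1 \<Longrightarrow> Re (poly g z) \<le> 1"
     and g2: "\<And>z. norm z = 1 \<Longrightarrow> norm (z - w) \<ge> \<delta> \<Longrightarrow> Re (poly g z) \<le> - 4 * \<kappa>"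
    using exists_poly_negative_off_arc[OF w, of \<delta>] \<delta> by fastforce
  define k where "k = degree g"
  have k: "k > 0"
  proof (rule ccontr)
    assume "\<not> k > 0"
    then obtain a where "g = [:a:]" unfolding k_def by (auto elim: degree_eq_zeroE)
    with g0 have "g = 0" by simp
    moreover have "norm (- w - w) = 2" using w by (metis minus_diff_eq norm_minus_cancel diff_minus_eq_add mult_2 norm_mult norm_numeral mult.right_neutral)
    ultimately show False using g2[of "-w"] w \<delta> \<kappa> by simp
  qed
  \<comment> \<open>\<open>G\<close> governs the displacement, \<open>g\<close> the polynomial
    \<open>P\<close>. Since \<open>Re g\<close> is at most 1 near \<open>w\<close> and at most
    \<open>- 4 * \<kappa>\<close> elsewhere, the lower bounds \<open>1 + 2 * \<kappa>\<close> and
    \<open>- (\<kappa> / 8)\<close> keep \<open>Re G\<close> above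
    \<open>Re g + 2 * \<kappa>\<close> all around the circle.\<close>
  obtain G where G1: "\<And>z. norm z = 1 \<Longrightarrow> Re (poly G z) \<ge> - (\<kappa> / 8)"
     and G2: "\<And>z. norm z = 1 \<Longrightarrow> norm (z - w) \<le> \<delta> \<Longrightarrow> Re (poly G z) \<ge> 1 + 2 * \<kappa>"
     and G3: "\<And>z. norm z = 1 \<Longrightarrow> norm (z - w) \<ge> 2 * \<delta> \<Longrightarrow> Re (poly G z) < 0"
    using exists_poly_above_on_arc[OF w \<delta>(1,2), of "\<kappa> / 8" "1 + 2 * \<kappa>"] \<kappa> by auto
  have G_ge: "Re (poly G z) \<ge> Re (poly g z) + 2 * \<kappa>" if "norm z = 1" for z
    using G1[OF that] G2[OF that] g1[OF that] g2[OF that] \<kappa> by (cases "norm (z - w) \<le> \<delta>") auto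
  \<comment> \<open>In the disc away from \<open>w\<close>, outward motion is possible only on
    \<open>C\<close>. By \<open>G3\<close> the set \<open>C\<close> misses the unit circle, so by
    compactness it leaves a margin \<open>1 - \<rho>\<close> for the displacement.\<close>
  define C where "C = cball 0 1 \<inter> {z. norm (z - w) \<ge> 2 * \<delta>} \<inter> {z. Re (poly G z) \<ge> 0}"
  have "compact C" unfolding C_def
    by (intro compact_Int_closed compact_cball closed_Collect_le continuous_intros)
  obtain \<rho> where \<rho>: "\<rho> < 1" "\<And>z. z \<in> C \<Longrightarrow> norm z \<le> \<rho>"
  proof (cases "C = {}")
    case False
    then obtain x where x: "x \<in> C" "\<And>z. z \<in> C \<Longrightarrow> norm z \<le> norm x"
      using continuous_attains_sup[OF \<open>compact C\<close>, of norm] by (auto intro: continuous_intros)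
    have "norm x < 1" using x(1) G3[of x] by (fastforce simp: C_def)
    then show ?thesis using x that by blast
  qed (use that[of 0] in auto)
  have "uniformly_continuous_on (cball 0 2) (poly g)"
    by (intro compact_uniformly_continuous continuous_intros) auto
  then obtain \<eta>0 where \<eta>0: "\<eta>0 > 0"
    "\<And>x y. x \<in> cball 0 2 \<Longrightarrow> y \<in> cball 0 2 \<Longrightarrow> dist y x < \<eta>0 \<Longrightarrow> dist (poly g y) (poly g x) < \<kappa> / 2"
    unfolding uniformly_continuous_on_def using \<kappa> by (metis half_gt_zero)
  have "bounded (poly g ` cball 0 2)"
    by (intro compact_imp_bounded compact_continuous_image continuous_intros) auto
  then obtain B where B: "B > 0" "\<And>z. z \<in> cball 0 2 \<Longrightarrow> norm (poly g z) \<le> B"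
    by (auto simp: bounded_pos)
  have "bounded (poly G ` cball 0 1)"
    by (intro compact_imp_bounded compact_continuous_image continuous_intros) auto
  then obtain B' where B': "B' > 0" "\<And>z. z \<in> cball 0 1 \<Longrightarrow> norm (poly G z) \<le> B'"
    by (auto simp: bounded_pos)
  \<comment> \<open>In turn: continuity of \<open>g\<close>, keeping images in
    \<open>cball 0 2\<close>, staying in \<open>ball w e\<close> near \<open>w\<close>, and keeping
    the image of \<open>C\<close> in the unit disc.\<close>
  define \<eta> where "\<eta> = min (min \<eta>0 1) (min (2 * \<delta>) (1 - \<rho>))"
  have \<eta>: "\<eta> > 0" "\<eta> \<le> \<eta>0" "\<eta> \<le> 1" "\<eta> \<le> 2 * \<delta>" "\<eta> \<le> 1 - \<rho>" using \<eta>0 \<delta> \<rho> by (auto simp: \<eta>_def)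
  have "(exp :: complex \<Rightarrow> complex) \<midarrow>0\<rightarrow> exp 0" by (intro isContD continuous_intros)
  then obtain \<epsilon> where \<epsilon>: "\<epsilon> > 0" "\<And>u :: complex. norm u < \<epsilon> \<Longrightarrow> norm (exp u - 1) < \<eta>"
    using \<eta>(1) unfolding LIM_def dist_norm by (metis diff_zero exp_zero norm_zero right_minus_eq)
  \<comment> \<open>The first bound keeps the displacement below \<open>\<eta>\<close>; the second
    makes the quadratic error \<open>s * B\<^sup>2 / 2\<close> at most
    \<open>\<kappa> / 2\<close>.\<close>
  define s where "s = min (\<epsilon> / (2 * B')) (\<kappa> / B\<^sup>2)"
  have s: "s > 0" "s * B' < \<epsilon>" "s * B\<^sup>2 \<le> \<kappa>"
  proof -
    show "s > 0" using \<epsilon> \<kappa> B B' by (simp add: s_def)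
    have "s * B' \<le> \<epsilon> / (2 * B') * B'" using B' by (intro mult_right_mono) (auto simp: s_def)
    also have "\<dots> < \<epsilon>" using B' \<epsilon> by simp
    finally show "s * B' < \<epsilon>" .
    have "s * B\<^sup>2 \<le> \<kappa> / B\<^sup>2 * B\<^sup>2" using B by (intro mult_right_mono) (auto simp: s_def)
    then show "s * B\<^sup>2 \<le> \<kappa>" using B by simp
  qed
  \<comment> \<open>Division by \<open>k\<close> anticipates the factor
    \<open>(1 / \<phi> z) ^ k\<close> in \<open>poly P (1 / \<phi> z)\<close>.\<close>
  define \<psi> where "\<psi> = smult (of_real (s / k)) G"
  define \<phi> where "\<phi> = (\<lambda>z. z * exp (poly \<psi> z))"
  have Re_\<psi>: "Re (poly \<psi> z) = s / k * Re (poly G z)" for z by (simp add: \<psi>_def)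
  have close: "norm (\<phi> z - z) < \<eta>" if "norm z \<le> 1" for z
  proof -
    have "norm (poly \<psi> z) = s / k * norm (poly G z)" using s k by (simp add: \<psi>_def norm_mult norm_divide)
    also have "\<dots> \<le> s / 1 * B'" using s k B' that by (intro mult_mono divide_left_mono) auto
    also have "\<dots> < \<epsilon>" using s by simp
    finally have "norm (exp (poly \<psi> z) - 1) < \<eta>" by (rule \<epsilon>)
    moreover have "norm (\<phi> z - z) = norm z * norm (exp (poly \<psi> z) - 1)"
      by (simp add: \<phi>_def algebra_simps flip: norm_mult)
    ultimately show ?thesis using that by (smt (verit) mult_left_le_one_le norm_ge_zero)
  qed
  have norm_\<phi>: "norm (\<phi> z) = norm z * exp (s / k * Re (poly G z))" for z
    by (simp add: \<phi>_def norm_mult Re_\<psi>)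
  \<comment> \<open>Reflection gives \<open>P (1 / x) = (1 / x) ^ k * Q x\<close>, so on the contour
    \<open>ln |P|\<close> is to first order
    \<open>s * (Re g - Re G) \<le> - 2 * s * \<kappa>\<close>. Half of this survives the error
    terms, whence \<open>l * k = s * \<kappa>\<close>.\<close>
  define Q where "Q = 1 + smult (of_real s) g"
  define P where "P = reflect_poly Q"
  have Q0: "coeff Q 0 = 1" using g0 by (simp add: Q_def poly_0_coeff_0)
  have degQ: "degree Q = k" using s k unfolding Q_def k_def by (simp add: degree_add_eq_right)
  have degP: "degree P = k" unfolding P_def using degQ Q0 by (simp add: degree_reflect_poly_eq)
  have leadP: "lead_coeff P = 1" using degP Q0 degQ by (simp add: P_def coeff_reflect_poly)
  define l where "l = s * \<kappa> / k"
  have 1: "\<phi> z \<in> ball 0 1 \<union> ball w e" if "norm z \<le> 1" for z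
  proof (cases "norm (z - w) < 2 * \<delta>")
    case True
    have "norm (\<phi> z - w) \<le> norm (\<phi> z - z) + norm (z - w)" by norm
    also have "\<dots> < e" using True close[OF that] \<eta> \<delta> by linarith
    finally show ?thesis by (simp add: dist_norm norm_minus_commute)
  next
    case False
    have "norm (\<phi> z) < 1"
    proof (cases "z \<in> C")
      case True
      have "norm (\<phi> z) \<le> norm (\<phi> z - z) + norm z" by norm
      then show ?thesis using \<rho>(2)[OF True] close[OF that] \<eta> by linarith
    next
      case nC: False
      show ?thesis
      proof (cases "z = 0")
        case False
        have "Re (poly G z) < 0" using nC that \<open>\<not> norm (z - w) < 2 * \<delta>\<close> by (auto simp: C_def)
        then have "exp (s / k * Re (poly G z)) < 1" using s k by (simp add: mult_neg_pos divide_neg_pos mult_pos_neg)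
        then have "norm (\<phi> z) < norm z * 1" unfolding norm_\<phi> using False by (intro mult_strict_left_mono) auto
        then show ?thesis using that by simp
      qed (simp add: \<phi>_def)
    qed
    then show ?thesis by simp
  qed
  have 2: "norm (1 / \<phi> z) \<le> exp (l / 8)" if "norm z = 1" for z
  proof -
    have "norm (1 / \<phi> z) = exp (- (s / k * Re (poly G z)))"
      using that by (simp add: norm_divide norm_\<phi> exp_minus divide_simps)
    also have "\<dots> \<le> exp (s / k * (\<kappa> / 8))"
    proof -
      have "s / k * (- (\<kappa> / 8)) \<le> s / k * Re (poly G z)" using G1[OF that] s by (intro mult_left_mono) auto
      then show ?thesis by simp
    qed
    finally show ?thesis by (simp add: l_def)
  qed
  have 3: "norm (poly P (1 / \<phi> z)) \<le> exp (- l * real k)" if "norm z = 1" for z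
  proof -
    have nz: "\<phi> z \<noteq> 0" using that by (auto simp: \<phi>_def)
    have "norm (\<phi> z) \<le> 2" 
    proof -
      have "norm (\<phi> z) \<le> norm (\<phi> z - z) + norm z" by norm
      then show ?thesis using that close[of z] \<eta> by linarith
    qed
    then have in2: "\<phi> z \<in> cball 0 2" "z \<in> cball 0 2" using that by auto
    have "poly P (1 / \<phi> z) = (1 / \<phi> z) ^ k * poly Q (\<phi> z)"
      unfolding P_def using poly_reflect_poly_nz[of "1 / \<phi> z" Q] nz degQ by (simp add: inverse_eq_divide)
    then have "norm (poly P (1 / \<phi> z)) = norm (poly Q (\<phi> z)) * exp (- (s * Re (poly G z)))"
    proof -
      have "norm (1 / \<phi> z) = exp (- (s / k * Re (poly G z)))"
        using that by (simp add: norm_divide norm_\<phi> exp_minus divide_simps)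
      then have "norm ((1 / \<phi> z) ^ k) = exp (real k * (- (s / k * Re (poly G z))))"
        unfolding norm_power exp_of_nat_mult by simp
      also have "real k * (- (s / k * Re (poly G z))) = - (s * Re (poly G z))" using k by simp
      finally show ?thesis using \<open>poly P (1 / \<phi> z) = _\<close> by (simp add: norm_mult)
    qed
    also have "norm (poly Q (\<phi> z)) \<le> exp (s * Re (poly g (\<phi> z)) + s * (s * (norm (poly g (\<phi> z)))\<^sup>2) / 2)"
      using norm_one_plus_le_exp[of "of_real s * poly g (\<phi> z)"] s
      by (simp add: Q_def norm_mult power_mult_distrib power2_eq_square[of s] mult.assoc)
    also have "exp (s * Re (poly g (\<phi> z)) + s * (s * (norm (poly g (\<phi> z)))\<^sup>2) / 2) * exp (- (s * Re (poly G z)))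
       = exp (s * (Re (poly g (\<phi> z)) + (s * (norm (poly g (\<phi> z)))\<^sup>2) / 2 - Re (poly G z)))"
      by (simp add: algebra_simps flip: exp_add)
    also have "\<dots> \<le> exp (s * (- \<kappa>))"
    proof -
      have "norm (poly g (\<phi> z) - poly g z) < \<kappa> / 2"
        using \<eta>0(2)[OF in2(2,1)] close[of z] that \<eta> by (simp add: dist_norm)
      then have a: "Re (poly g (\<phi> z)) - Re (poly g z) < \<kappa> / 2"
        using complex_Re_le_cmod[of "poly g (\<phi> z) - poly g z"] by simp
      have "s * (norm (poly g (\<phi> z)))\<^sup>2 \<le> s * B\<^sup>2" using s B(2)[OF in2(1)] by (intro mult_left_mono power_mono) auto
      then have "s * (norm (poly g (\<phi> z)))\<^sup>2 / 2 \<le> \<kappa> / 2" using s(3) by argo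
      with a G_ge[OF that] have "Re (poly g (\<phi> z)) + (s * (norm (poly g (\<phi> z)))\<^sup>2) / 2 - Re (poly G z) \<le> - \<kappa>"
        by linarith
      then show ?thesis using s by (simp only: exp_le_cancel_iff mult_left_mono less_imp_le)
    qed
    also have "s * (- \<kappa>) = - l * real k" using k by (simp add: l_def)
    finally show ?thesis by simp
  qed
  show ?thesis
    using 1 2 3 degP leadP k s \<kappa> unfolding \<phi>_def
    by (intro exI[of _ P] exI[of _ \<psi>] exI[of _ l]) (auto simp: l_def)
qed

section \<open>The coefficient functional as a contour integral\<close>

text \<open>The factor \<open>1 / z + poly (pderiv \<psi>) z\<close> is
  \<open>\<phi>' / \<phi>\<close>. For \<open>n > 0\<close> the integrand has the primitive
  \<open>- (1 / \<phi>) ^ n / n\<close>; for \<open>n = 0\<close> only the pole at 0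
  contributes.\<close>

lemma contour_integral_deformed_circle_power:
  fixes \<psi> :: "complex poly" and n :: nat
  defines "\<phi> \<equiv> \<lambda>z. z * exp (poly \<psi> z)"
  shows "((\<lambda>z. (1 / \<phi> z) ^ n * (1 / z + poly (pderiv \<psi>) z)) has_contour_integral
           (if n = 0 then 2 * pi * \<i> else 0)) (circlepath 0 1)"
proof (cases "n = 0")
  case True
  have "((\<lambda>z. 1 / (z - 0)) has_contour_integral 2 * pi * \<i>) (circlepath 0 1)"
    using Cauchy_integral_circlepath_simple[of "\<lambda>_. 1" 0 1 0] by simp
  moreover have "(poly (pderiv \<psi>) has_contour_integral 0) (circlepath 0 1)"
    by (rule Cauchy_theorem_convex_simple[of _ UNIV]) (auto intro!: holomorphic_intros)
  ultimately show ?thesis using True by (auto dest: has_contour_integral_add)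
next
  case False
  have "((\<lambda>z. (1 / \<phi> z) ^ n * (1 / z + poly (pderiv \<psi>) z)) has_contour_integral 0) (circlepath 0 1)"
  proof (rule Cauchy_theorem_primitive[of "UNIV - {0}"])
    fix z :: complex assume z: "z \<in> UNIV - {0}"
    then have nz: "\<phi> z \<noteq> 0" by (simp add: \<phi>_def)
    have d: "(\<phi> has_field_derivative \<phi> z * (1 / z + poly (pderiv \<psi>) z)) (at z within UNIV - {0})"
      unfolding \<phi>_def by (rule derivative_eq_intros refl | use z in \<open>simp add: field_simps\<close>)+
    show "((\<lambda>z. - (1 / of_nat n) * (1 / \<phi> z) ^ n) has_field_derivative
          (1 / \<phi> z) ^ n * (1 / z + poly (pderiv \<psi>) z)) (at z within UNIV - {0})"
    proof (rule DERIV_cong[OF DERIV_cmult[OF DERIV_power]])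
      show "((\<lambda>z. 1 / \<phi> z) has_field_derivative - (1 / \<phi> z) * (1 / z + poly (pderiv \<psi>) z)) (at z within UNIV - {0})"
        by (rule derivative_eq_intros d refl nz)+ (use nz in simp)
      have "(1 / \<phi> z) ^ n = (1 / \<phi> z) * (1 / \<phi> z) ^ (n - Suc 0)"
        using False by (cases n) auto
      then show "- (1 / of_nat n) * (of_nat n * (- (1 / \<phi> z) * (1 / z + poly (pderiv \<psi>) z) * (1 / \<phi> z) ^ (n - Suc 0)))
            = (1 / \<phi> z) ^ n * (1 / z + poly (pderiv \<psi>) z)"
        using False by simp
    qed
  qed auto
  then show ?thesis using False by simp
qed

text \<open>Up to the factor \<open>2 * pi * \<i>\<close>, the functional sending
  \<open>x ^ i\<close> to the coefficient of index \<open>i\<close> integrates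
  \<open>p (1 / \<phi>)\<close> against \<open>f (\<phi>) * \<phi>' / \<phi>\<close>. In place of a
  deformation of the circle, \<open>f\<close> is split into a Taylor polynomial, covered by the
  preceding lemma, and a remainder divisible by \<open>z ^ Suc n\<close>, to which Cauchy's theorem
  applies after pulling back under \<open>\<phi>\<close>.\<close>

lemma coeff_functional_bound:
  fixes F :: "complex fps" and \<psi> :: "complex poly"
  defines "\<phi> \<equiv> \<lambda>z. z * exp (poly \<psi> z)"
  assumes R: "fps_conv_radius F \<ge> 1"
    and S: "open S" "ball 0 1 \<subseteq> S" and f: "f holomorphic_on S"
    and fF: "\<And>z. z \<in> ball 0 1 \<Longrightarrow> f z = eval_fps F z"
    and \<phi>: "\<And>z. norm z \<le> 1 \<Longrightarrow> \<phi> z \<in> S"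
  shows "\<exists>M. \<forall>p B. (\<forall>z. norm z = 1 \<longrightarrow> norm (poly p (1 / \<phi> z)) \<le> B) \<longrightarrow>
           norm (\<Sum>i\<le>degree p. coeff p i * fps_nth F i) \<le> M * B"
proof -
  define \<omega> where "\<omega> = (\<lambda>z. 1 / z + poly (pderiv \<psi>) z)"
  have hol_\<phi>: "\<phi> holomorphic_on A" for A unfolding \<phi>_def by (intro holomorphic_intros)
  have main: "((\<lambda>z. f (\<phi> z) * (1 / \<phi> z) ^ n * \<omega> z) has_contour_integral 2 * pi * \<i> * fps_nth F n) (circlepath 0 1)" for n
  proof -
    \<comment> \<open>The quotient describes \<open>h\<close> away from 0 and the shifted series
      describes it in the disc; they agree where both make sense.\<close>
    define h where "h = (\<lambda>z. if z \<in> ball 0 1 then eval_fps (fps_shift (Suc n) F) z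
                             else (f z - (\<Sum>i\<le>n. fps_nth F i * z ^ i)) / z ^ Suc n)"
    have eval_split: "eval_fps F z = (\<Sum>i\<le>n. fps_nth F i * z ^ i) + z ^ Suc n * eval_fps (fps_shift (Suc n) F) z"
      if "z \<in> ball 0 1" for z
    proof -
      have "ereal (norm z) < fps_conv_radius F" using that R by (simp add: less_le_trans[of _ "1::ereal"])
      then have sm: "summable (\<lambda>i. fps_nth F i * z ^ i)" by (rule summable_fps)
      have "eval_fps F z = (\<Sum>i. fps_nth F (i + Suc n) * z ^ (i + Suc n)) + (\<Sum>i<Suc n. fps_nth F i * z ^ i)"
        unfolding eval_fps_def by (rule suminf_split_initial_segment[OF sm])
      also have "(\<Sum>i. fps_nth F (i + Suc n) * z ^ (i + Suc n)) = (\<Sum>i. z ^ Suc n * (fps_nth F (i + Suc n) * z ^ i))"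
        by (simp add: power_add mult_ac)
      also have "\<dots> = z ^ Suc n * eval_fps (fps_shift (Suc n) F) z"
        unfolding eval_fps_def
      proof (subst suminf_mult)
        have "ereal (norm z) < fps_conv_radius (fps_shift (Suc n) F)" using \<open>ereal (norm z) < _\<close> by simp
        then show "summable (\<lambda>i. fps_nth F (i + Suc n) * z ^ i)" using summable_fps by fastforce
      qed simp
      finally show ?thesis by (simp add: lessThan_Suc_atMost add.commute)
    qed
    have hol1: "h holomorphic_on ball 0 1"
    proof (rule holomorphic_transform)
      show "eval_fps (fps_shift (Suc n) F) holomorphic_on ball 0 1"
        using R by (intro holomorphic_intros) (auto simp: in_eball_iff less_le_trans[of _ "1::ereal"])
    qed (simp add: h_def)
    have heq: "h z = (f z - (\<Sum>i\<le>n. fps_nth F i * z ^ i)) / z ^ Suc n" if "z \<noteq> 0" for z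
    proof (cases "z \<in> ball 0 1")
      case True
      then show ?thesis using that fF[OF True] eval_split[OF True] by (simp add: h_def)
    qed (auto simp: h_def)
    have hol2: "h holomorphic_on (S - {0})"
    proof (rule holomorphic_transform)
      show "(\<lambda>z. (f z - (\<Sum>i\<le>n. fps_nth F i * z ^ i)) / z ^ Suc n) holomorphic_on S - {0}"
        using f by (intro holomorphic_intros holomorphic_on_subset[OF f]) auto
    qed (simp add: heq)
    have "h holomorphic_on (ball 0 1 \<union> (S - {0}))"
      using hol1 hol2 S by (intro holomorphic_on_Un) auto
    then have h: "h holomorphic_on S" by (rule holomorphic_on_subset) auto
    have dec: "f z = (\<Sum>i\<le>n. fps_nth F i * z ^ i) + z ^ Suc n * h z" if "z \<noteq> 0" for z
      using heq[OF that] that by simp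
    \<comment> \<open>This is \<open>\<phi> ^ Suc n * h (\<phi>) * (1 / \<phi>) ^ n * \<phi>' /
      \<phi>\<close> after cancellation, in which no pole at 0 remains.\<close>
    define u where "u = (\<lambda>z. exp (poly \<psi> z) * h (\<phi> z) * (1 + z * poly (pderiv \<psi>) z))"
    have "(h \<circ> \<phi>) holomorphic_on cball 0 1"
      by (rule holomorphic_on_compose_gen[OF hol_\<phi> h]) (use \<phi> in auto)
    then have "u holomorphic_on cball 0 1"
      unfolding u_def o_def by (intro holomorphic_intros)
    then have "(u has_contour_integral 0) (circlepath 0 1)"
      by (rule Cauchy_theorem_convex_simple) auto
    moreover have "((\<lambda>z. \<Sum>i\<le>n. fps_nth F i * ((1 / \<phi> z) ^ (n - i) * \<omega> z)) has_contour_integral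
                    (\<Sum>i\<le>n. fps_nth F i * (if n - i = 0 then 2 * pi * \<i> else 0))) (circlepath 0 1)"
      unfolding \<omega>_def \<phi>_def
      by (intro has_contour_integral_sum has_contour_integral_lmul contour_integral_deformed_circle_power) auto
    ultimately have "((\<lambda>z. (\<Sum>i\<le>n. fps_nth F i * ((1 / \<phi> z) ^ (n - i) * \<omega> z)) + u z) has_contour_integral
        (\<Sum>i\<le>n. fps_nth F i * (if n - i = 0 then 2 * pi * \<i> else 0)) + 0) (circlepath 0 1)"
      by (intro has_contour_integral_add)
    also have "(\<Sum>i\<le>n. fps_nth F i * (if n - i = 0 then 2 * pi * \<i> else 0)) + 0
             = (\<Sum>i\<in>{n}. fps_nth F i * (if n - i = 0 then 2 * pi * \<i> else 0))"
      by (subst sum.mono_neutral_right[of "{..n}" "{n}"]) auto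
    also have "\<dots> = 2 * pi * \<i> * fps_nth F n" by simp
    finally show ?thesis
    proof (rule has_contour_integral_eq)
      fix z assume "z \<in> path_image (circlepath (0::complex) 1)"
      then have z: "z \<noteq> 0" "\<phi> z \<noteq> 0" by (auto simp: \<phi>_def)
      have "(\<Sum>i\<le>n. fps_nth F i * ((1 / \<phi> z) ^ (n - i) * \<omega> z)) = (\<Sum>i\<le>n. fps_nth F i * \<phi> z ^ i) * ((1 / \<phi> z) ^ n * \<omega> z)"
        unfolding sum_distrib_right
      proof (rule sum.cong[OF refl])
        fix i assume "i \<in> {..n}"
        then obtain d where "n = i + d" using le_Suc_ex by auto
        then show "fps_nth F i * ((1 / \<phi> z) ^ (n - i) * \<omega> z) = fps_nth F i * \<phi> z ^ i * ((1 / \<phi> z) ^ n * \<omega> z)"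
          using z by (simp add: power_add power_divide)
      qed
      moreover have "u z = \<phi> z ^ Suc n * h (\<phi> z) * ((1 / \<phi> z) ^ n * \<omega> z)"
        using z by (simp add: u_def \<omega>_def power_divide) (simp add: \<phi>_def field_simps)
      ultimately show "(\<Sum>i\<le>n. fps_nth F i * ((1 / \<phi> z) ^ (n - i) * \<omega> z)) + u z = f (\<phi> z) * (1 / \<phi> z) ^ n * \<omega> z"
        unfolding dec[OF z(2)] by (simp add: algebra_simps)
    qed
  qed
  have "continuous_on (sphere 0 1) (\<lambda>z. f (\<phi> z) * \<omega> z)"
  proof -
    have "(f \<circ> \<phi>) holomorphic_on sphere 0 1"
      by (rule holomorphic_on_compose_gen[OF hol_\<phi> f]) (use \<phi> in auto)
    then have "continuous_on (sphere 0 1) (\<lambda>z. f (\<phi> z))"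
      using holomorphic_on_imp_continuous_on by (auto simp: o_def)
    then show ?thesis unfolding \<omega>_def by (intro continuous_intros) auto
  qed
  then have "bounded ((\<lambda>z. f (\<phi> z) * \<omega> z) ` sphere 0 1)"
    by (intro compact_imp_bounded compact_continuous_image) auto
  then obtain M where M: "M > 0" "\<And>z. norm z = 1 \<Longrightarrow> norm (f (\<phi> z) * \<omega> z) \<le> M"
    by (auto simp: bounded_pos)
  have "norm (\<Sum>i\<le>degree p. coeff p i * fps_nth F i) \<le> M * B"
    if B: "\<And>z. norm z = 1 \<Longrightarrow> norm (poly p (1 / \<phi> z)) \<le> B" for p B
  proof -
    have "B \<ge> 0" using B[of 1] by (smt (verit) norm_ge_zero norm_one)
    have "((\<lambda>z. \<Sum>i\<le>degree p. coeff p i * (f (\<phi> z) * (1 / \<phi> z) ^ i * \<omega> z)) has_contour_integral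
           (\<Sum>i\<le>degree p. coeff p i * (2 * pi * \<i> * fps_nth F i))) (circlepath 0 1)"
      by (intro has_contour_integral_sum has_contour_integral_lmul main) auto
    also have "(\<lambda>z. \<Sum>i\<le>degree p. coeff p i * (f (\<phi> z) * (1 / \<phi> z) ^ i * \<omega> z)) =
               (\<lambda>z. f (\<phi> z) * \<omega> z * poly p (1 / \<phi> z))"
      unfolding poly_altdef sum_distrib_left by (intro ext sum.cong) (auto simp: mult_ac)
    also have "(\<Sum>i\<le>degree p. coeff p i * (2 * pi * \<i> * fps_nth F i)) = 2 * pi * \<i> * (\<Sum>i\<le>degree p. coeff p i * fps_nth F i)"
      unfolding sum_distrib_left by (intro sum.cong) (auto simp: mult_ac)
    finally have "norm (2 * pi * \<i> * (\<Sum>i\<le>degree p. coeff p i * fps_nth F i)) \<le> (M * B) * (2 * pi * 1)"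
    proof (rule has_contour_integral_bound_circlepath)
      fix z :: complex assume "norm (z - 0) = 1"
      then have z: "norm z = 1" by simp
      show "norm (f (\<phi> z) * \<omega> z * poly p (1 / \<phi> z)) \<le> M * B"
        unfolding norm_mult[of "f (\<phi> z) * \<omega> z"] using M B[OF z] M(2)[OF z] \<open>B \<ge> 0\<close> by (intro mult_mono) auto
    qed (use M \<open>B \<ge> 0\<close> in auto)
    then show ?thesis by (simp add: norm_mult mult.commute)
  qed
  then show ?thesis by blast
qed

text \<open>Linearity of the functional sending \<open>x ^ i\<close> to \<open>a i\<close>:
  precomposed with multiplication by \<open>s\<close>, it sends \<open>x ^ j\<close> to the defect
  of the relation \<open>q\<close> at shift \<open>j\<close>. A bound for the functional on
  \<open>s * p\<close> thus controls these defects.\<close>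

lemma coeff_functional_mult:
  fixes a q :: "nat \<Rightarrow> 'a::comm_ring_1" and p :: "'a poly" and N :: nat
  defines "s \<equiv> \<Sum>i<N. monom (q i) i"
  shows "(\<Sum>i\<le>degree (s * p). coeff (s * p) i * a i) =
         (\<Sum>j\<le>degree p. coeff p j * (\<Sum>i<N. q i * a (i + j)))"
proof -
  \<comment> \<open>A common cutoff beyond all exponents involved; a sum that stops at the degree is
    not visibly linear in the polynomial.\<close>
  define T where "T = degree (s * p) + degree p + N + 1"
  define \<Lambda> where "\<Lambda> = (\<lambda>r. \<Sum>i<T. coeff r i * a i)"
  have \<Lambda>_sum: "\<Lambda> (\<Sum>x\<in>X. r x) = (\<Sum>x\<in>X. \<Lambda> (r x))" for X :: "nat set" and r
    unfolding \<Lambda>_def coeff_sum sum_distrib_right by (rule sum.swap)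
  have \<Lambda>_monom: "\<Lambda> (monom b n) = b * a n" if "n < T" for b n
    using that unfolding \<Lambda>_def coeff_monom by (simp add: if_distrib[of "\<lambda>x. x * _"] cong: if_cong)
  have "(\<Sum>i\<le>degree (s * p). coeff (s * p) i * a i) = \<Lambda> (s * p)"
    unfolding \<Lambda>_def by (rule sum.mono_neutral_left) (auto simp: T_def coeff_eq_0)
  moreover have sp: "s * p = (\<Sum>j\<le>degree p. \<Sum>i<N. monom (coeff p j * q i) (i + j))"
  proof -
    have "s * p = s * (\<Sum>j\<le>degree p. monom (coeff p j) j)" by (simp add: poly_as_sum_of_monoms)
    also have "\<dots> = (\<Sum>j\<le>degree p. \<Sum>i<N. monom (coeff p j * q i) (i + j))"
      unfolding s_def sum_distrib_left sum_distrib_right by (simp add: mult_monom mult.commute)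
    finally show ?thesis .
  qed
  moreover have "\<Lambda> (s * p) = (\<Sum>j\<le>degree p. \<Sum>i<N. (coeff p j * q i) * a (i + j))"
    unfolding sp \<Lambda>_sum by (intro sum.cong refl \<Lambda>_monom) (auto simp: T_def)
  ultimately show ?thesis by (simp add: sum_distrib_left mult.assoc)
qed

lemma subexponential_coeffs:
  fixes F :: "complex fps"
  assumes "fps_conv_radius F \<ge> 1" "\<epsilon> > 0"
  shows "\<exists>C\<ge>1. \<forall>n. norm (fps_nth F n) \<le> C * exp (\<epsilon> * real n)"
proof -
  have "norm (of_real (exp (- \<epsilon>)) :: complex) < 1" using assms by simp
  then have "ereal (norm (of_real (exp (- \<epsilon>)) :: complex)) < fps_conv_radius F"
    using assms(1) by (simp add: less_le_trans[of _ "1::ereal"])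
  then have "summable (\<lambda>n. fps_nth F n * of_real (exp (- \<epsilon>)) ^ n)" by (rule summable_fps)
  then have "Bseq (\<lambda>n. fps_nth F n * of_real (exp (- \<epsilon>)) ^ n)"
    by (intro convergent_imp_Bseq) (auto dest!: summable_LIMSEQ_zero simp: convergent_def)
  then obtain C where C: "\<And>n. norm (fps_nth F n * of_real (exp (- \<epsilon>)) ^ n) \<le> C"
    unfolding Bseq_def by blast
  have "norm (fps_nth F n) \<le> max C 1 * exp (\<epsilon> * real n)" for n
  proof -
    have "norm (fps_nth F n) * exp (- \<epsilon>) ^ n \<le> max C 1"
      using C[of n] by (simp add: norm_mult norm_power max.coboundedI1)
    then have "norm (fps_nth F n) * exp (- \<epsilon>) ^ n * exp (\<epsilon> * real n) \<le> max C 1 * exp (\<epsilon> * real n)"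
      by (intro mult_right_mono) auto
    moreover have "exp (- \<epsilon>) ^ n * exp (\<epsilon> * real n) = 1"
      unfolding exp_of_nat_mult[symmetric] exp_add[symmetric] by simp
    ultimately show ?thesis by (simp add: mult.assoc)
  qed
  then show ?thesis by (intro exI[of _ "max C 1"]) auto
qed

text \<open>
  The integers \<open>d j\<close> attached to a suitable small relation vanish: the first ones by construction,
  the others because replacing \<open>x ^ j\<close> by a power of the polynomial of small capacity shows
  \<open>|d j| < 1\<close>.
\<close>

theorem Polya_Carlson:
  fixes c :: "nat \<Rightarrow> int" and w :: complex
  defines "F \<equiv> Abs_fps (\<lambda>n. of_int (c n) :: complex)"
  assumes R: "fps_conv_radius F \<ge> 1" and w: "norm w = 1"
    and cont: "continues_analytically_across F 1 w"
  shows "\<exists>q N. (\<exists>i<N. q i \<noteq> 0) \<and> (\<forall>j. (\<Sum>i<N. q i * c (i + j)) = 0)"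
proof -
  obtain e f0 where e: "e > 0" and f0: "f0 holomorphic_on ball w e"
     and f0F: "\<And>z. z \<in> ball w e \<inter> ball 0 1 \<Longrightarrow> f0 z = eval_fps F z"
    using cont unfolding continues_analytically_across_def by blast
  define f where "f = (\<lambda>z. if z \<in> ball 0 1 then eval_fps F z else f0 z)"
  have "f holomorphic_on ball 0 1"
  proof (rule holomorphic_transform)
    show "eval_fps F holomorphic_on ball 0 1"
      using R by (intro holomorphic_intros) (auto simp: in_eball_iff less_le_trans[of _ "1::ereal"])
  qed (simp add: f_def)
  moreover have "f holomorphic_on ball w e"
    by (rule holomorphic_transform[OF f0]) (use f0F in \<open>auto simp: f_def\<close>)
  ultimately have f: "f holomorphic_on ball 0 1 \<union> ball w e"
    by (intro holomorphic_on_Un) auto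
  obtain P \<psi> l where P: "degree P > 0" "lead_coeff P = 1" and l: "l > 0"
    and S: "\<And>z. norm z \<le> 1 \<Longrightarrow> z * exp (poly \<psi> z) \<in> ball 0 1 \<union> ball w e"
    and P_le: "\<And>z. norm z = 1 \<Longrightarrow> norm (poly P (1 / (z * exp (poly \<psi> z)))) \<le> exp (- l * real (degree P))"
    and inv_le: "\<And>z. norm z = 1 \<Longrightarrow> norm (1 / (z * exp (poly \<psi> z))) \<le> exp (l / 8)"
    using exists_deformed_circle[OF w e] by blast
  define \<phi> where "\<phi> = (\<lambda>z. z * exp (poly \<psi> z))"
  define k where "k = degree P"
  obtain M where M: "\<And>p B. (\<And>z. norm z = 1 \<Longrightarrow> norm (poly p (1 / \<phi> z)) \<le> B) \<Longrightarrow>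
           norm (\<Sum>i\<le>degree p. coeff p i * fps_nth F i) \<le> M * B"
    using coeff_functional_bound[OF R _ _ f _ S] unfolding \<phi>_def by (auto simp: f_def)
  \<comment> \<open>Monic of degree \<open>j\<close> like \<open>x ^ j\<close>, but small on the
    contour; the remainder of \<open>j\<close> modulo \<open>k\<close> is made up by powers of
    \<open>x\<close>.\<close>
  define Pj where "Pj = (\<lambda>j. P ^ (j div k) * monom 1 (j mod k))"
  have "P \<noteq> 0" using P by auto
  have degPj: "degree (Pj j) = j" for j
    unfolding Pj_def using \<open>P \<noteq> 0\<close>
    by (subst degree_mult_eq) (auto simp: degree_power_eq degree_monom_eq k_def monom_eq_0_iff)
  have leadPj: "coeff (Pj j) j = 1" for j
  proof -
    have "lead_coeff (Pj j) = 1" unfolding Pj_def by (simp add: lead_coeff_mult lead_coeff_power P degree_monom_eq)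
    then show ?thesis by (simp add: degPj)
  qed
  \<comment> \<open>Pays for the fewer than \<open>k\<close> leftover factors \<open>x\<close>: each
    misses the saving \<open>l\<close> and costs up to \<open>l / 8\<close>.\<close>
  define C1 where "C1 = exp (2 * l * k)"
  have Pj_le: "norm (poly (Pj j) (1 / \<phi> z)) \<le> C1 * exp (- l * real j)" if z: "norm z = 1" for j z
  proof -
    have "norm (poly (Pj j) (1 / \<phi> z)) = norm (poly P (1 / \<phi> z)) ^ (j div k) * norm (1 / \<phi> z) ^ (j mod k)"
      by (simp add: Pj_def poly_monom norm_mult norm_power)
    also have "\<dots> \<le> exp (- l * real k) ^ (j div k) * exp (l / 8) ^ (j mod k)"
      using P_le[OF z] inv_le[OF z] by (intro mult_mono power_mono) (auto simp: \<phi>_def k_def)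
    also have "\<dots> = exp (- l * real (k * (j div k)) + l / 8 * real (j mod k))"
      unfolding exp_of_nat_mult[symmetric] exp_add[symmetric] by (simp add: algebra_simps)
    also have "\<dots> \<le> exp (2 * l * k + (- l * real j))"
    proof -
      have "real j = real (k * (j div k)) + real (j mod k)" by (metis mult_div_mod_eq of_nat_add)
      moreover have "real (j mod k) \<le> real k" using P by (simp add: k_def less_imp_le)
      ultimately have "- l * real (k * (j div k)) + l / 8 * real (j mod k) = - l * real j + 9/8 * l * real (j mod k)"
        by (simp add: algebra_simps)
      also have "9/8 * l * real (j mod k) \<le> 2 * l * real k"
        using l \<open>real (j mod k) \<le> real k\<close> by (intro mult_mono) auto
      finally show ?thesis by simp
    qed
    finally show ?thesis by (simp only: C1_def exp_add)
  qed
  obtain C0 where C0: "C0 \<ge> 1" "\<And>n. norm (fps_nth F n) \<le> C0 * exp (l / 12 * real n)"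
    using subexponential_coeffs[OF R, of "l / 12"] l by auto
  define K where "K = \<bar>M\<bar> * 16 * C0 * C1"
  have "(\<lambda>J. K * real J ^ 2 * exp (- l / 2 * real J)) \<longlonglongrightarrow> 0" using l by real_asymp
  then have "eventually (\<lambda>J. K * real J ^ 2 * exp (- l / 2 * real J) < 1) sequentially"
    by (rule order_tendstoD) simp
  then have "eventually (\<lambda>J. K * real J ^ 2 * exp (- l / 2 * real J) < 1 \<and> J \<ge> 1) sequentially"
    using eventually_ge_at_top[of 1] by (rule eventually_conj)
  then obtain J where J: "K * real J ^ 2 * exp (- l / 2 * real J) < 1" "J \<ge> 1"
    unfolding eventually_sequentially by blast
  define B where "B = \<lceil>C0 * exp (l / 4 * real J)\<rceil>"
  have big: "1 \<le> C0 * exp (l / 4 * real J)"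
    using C0 l mult_mono[of 1 C0 1 "exp (l / 4 * real J)"] by simp
  have cB: "\<bar>c n\<bar> \<le> B" if "n < 3 * J" for n
  proof -
    have "real_of_int \<bar>c n\<bar> \<le> C0 * exp (l / 12 * real n)" using C0(2)[of n] by (simp add: F_def)
    also have "\<dots> \<le> C0 * exp (l / 12 * real (3 * J))" using that C0 l by (intro mult_left_mono) auto
    finally show ?thesis unfolding B_def by (simp add: le_ceiling_iff)
  qed
  have B1: "B \<ge> 1" using big by (simp add: B_def)
  have B2: "real_of_int B \<le> 2 * (C0 * exp (l / 4 * real J))" using big unfolding B_def by linarith
  obtain q where q0: "\<exists>i<2*J. q i \<noteq> 0" and qle: "\<And>i. \<bar>q i\<bar> \<le> 4 * int J * B"
    and q: "\<And>j. j < J \<Longrightarrow> (\<Sum>i<2*J. q i * c (i + j)) = 0"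
    using integer_relations_exist[OF J(2) B1, of c] cB by blast
  define d where "d = (\<lambda>j. \<Sum>i<2*J. q i * c (i + j))"
  define s where "s = (\<Sum>i<2*J. monom (of_int (q i) :: complex) i)"
  have s_le: "norm (poly s (1 / \<phi> z)) \<le> 2 * real J * (4 * real J * B) * exp (l / 4 * real J)" if z: "norm z = 1" for z
  proof -
    have "norm (poly s (1 / \<phi> z)) \<le> (\<Sum>i<2*J. norm (of_int (q i) * (1 / \<phi> z) ^ i))"
      unfolding s_def poly_sum poly_monom by (rule norm_sum)
    also have "\<dots> \<le> (\<Sum>i<2*J. (4 * real J * B) * exp (l / 4 * real J))"
    proof (rule sum_mono)
      fix i assume i: "i \<in> {..<2*J}"
      have "norm (of_int (q i) :: complex) \<le> 4 * real J * B"
      proof -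
        have "real_of_int \<bar>q i\<bar> \<le> real_of_int (4 * int J * B)" using qle[of i] by (simp only: of_int_le_iff)
        then show ?thesis by simp
      qed
      moreover have "norm ((1 / \<phi> z) ^ i) \<le> exp (l / 4 * real J)"
      proof -
        have "norm ((1 / \<phi> z) ^ i) \<le> exp (l / 8) ^ i"
          using inv_le[OF z] unfolding norm_power \<phi>_def by (intro power_mono) auto
        also have "\<dots> = exp (real i * (l / 8))" by (simp flip: exp_of_nat_mult)
        also have "\<dots> \<le> exp (real (2 * J) * (l / 8))" using i l by (intro iffD2[OF exp_le_cancel_iff] mult_right_mono) auto
        finally show ?thesis by (simp add: mult.commute)
      qed
      ultimately show "norm (of_int (q i) * (1 / \<phi> z) ^ i) \<le> (4 * real J * B) * exp (l / 4 * real J)"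
        unfolding norm_mult by (intro mult_mono) (use B1 in auto)
    qed
    finally show ?thesis by simp
  qed
  have "d j = 0" for j
  proof (induction j rule: less_induct)
    case (less j)
    show ?case
    proof (cases "j < J")
      case True
      then show ?thesis using q by (simp add: d_def)
    next
      case False
      have "norm (poly (s * Pj j) (1 / \<phi> z)) \<le> (2 * real J * (4 * real J * B) * exp (l / 4 * real J)) * (C1 * exp (- l * real j))"
        if "norm z = 1" for z
        unfolding poly_mult norm_mult using s_le[OF that] Pj_le[OF that] B1 by (intro mult_mono) auto
      then have "norm (\<Sum>i\<le>degree (s * Pj j). coeff (s * Pj j) i * fps_nth F i) \<le>
         M * ((2 * real J * (4 * real J * B) * exp (l / 4 * real J)) * (C1 * exp (- l * real j)))" by (rule M)
      also have "\<dots> \<le> \<bar>M\<bar> * ((2 * real J * (4 * real J * (2 * (C0 * exp (l / 4 * real J)))) * exp (l / 4 * real J)) * (C1 * exp (- l * real J)))"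
        using B1 B2 C0 l False by (intro mult_mono mult_left_mono) (auto simp: C1_def)
      also have "\<dots> = K * real J ^ 2 * (exp (l / 4 * real J) * exp (l / 4 * real J) * exp (- l * real J))"
        by (simp add: K_def power2_eq_square mult_ac)
      also have "exp (l / 4 * real J) * exp (l / 4 * real J) * exp (- l * real J) = exp (- l / 2 * real J)"
        unfolding exp_add[symmetric] by (simp add: algebra_simps)
      also note J(1)
      \<comment> \<open>The functional on \<open>s * Pj j\<close> is a combination of
        \<open>d 0, ..., d j\<close>. By induction only \<open>d j\<close> survives, with leading
        coefficient 1, and an integer of modulus below 1 vanishes.\<close>
      also have "(\<Sum>i\<le>degree (s * Pj j). coeff (s * Pj j) i * fps_nth F i) = (\<Sum>i\<le>j. coeff (Pj j) i * of_int (d i))"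
        unfolding s_def coeff_functional_mult degPj by (simp add: d_def F_def)
      also have "\<dots> = (\<Sum>i\<in>{j}. coeff (Pj j) i * of_int (d i))"
        by (rule sum.mono_neutral_right) (use less in auto)
      also have "\<dots> = of_int (d j)" using leadPj by simp
      finally have "real_of_int \<bar>d j\<bar> < 1" by simp
      then show ?thesis by linarith
    qed
  qed
  then show ?thesis using q0 unfolding d_def by blast
qed

section \<open>Rational functions without zeros and poles in the unit disc\<close>

text \<open>A root \<open>\<rho>\<close> outside the open unit disc contributes \<open>X / (X - \<rho>) = - (\<Sum>n\<ge>1. (X / \<rho>) ^ n)\<close>.\<close>

lemma bounded_log_derivative_poly:
  fixes T :: "complex poly"
  assumes "T \<noteq> 0" and "\<And>z. norm z < 1 \<Longrightarrow> poly T z \<noteq> 0"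
  shows "\<exists>A. fps_X * fps_deriv (fps_of_poly T) = fps_of_poly T * A \<and>
             (\<forall>n. norm (fps_nth A n) \<le> real (degree T))"
  using assms
proof (induction "degree T" arbitrary: T)
  case 0
  then obtain a where "T = [:a:]" by (metis degree_eq_zeroE)
  then show ?case using "0.hyps" by (intro exI[of _ 0]) (simp add: fps_of_poly_pCons)
next
  case (Suc m)
  then obtain \<rho> where \<rho>: "poly T \<rho> = 0" 
    using fundamental_theorem_of_algebra[of "coeff T" "degree T"] unfolding poly_altdef
    by (metis Suc.hyps(2) Suc.prems(1) Suc_le_eq atLeastAtMost_iff leading_coeff_0_iff One_nat_def order_refl zero_less_Suc)
  then obtain T1 where T: "T = [:- \<rho>, 1:] * T1" by (metis poly_eq_0_iff_dvd dvd_def)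
  have nz: "T1 \<noteq> 0" using Suc.prems T by auto
  have deg: "degree T = Suc (degree T1)" unfolding T using nz by (subst degree_mult_eq) auto
  have \<rho>1: "norm \<rho> \<ge> 1" using \<rho> Suc.prems(2) by force
  have \<rho>0: "\<rho> \<noteq> 0" using \<rho>1 by auto
  obtain A where A: "fps_X * fps_deriv (fps_of_poly T1) = fps_of_poly T1 * A"
     "\<And>n. norm (fps_nth A n) \<le> real (degree T1)"
    using Suc.hyps(1)[of T1] Suc.hyps(2) deg nz Suc.prems(2) T by auto
  define E where "E = Abs_fps (\<lambda>n. if n = 0 then 0 else - ((1 / \<rho>) ^ n))"
  have E: "(fps_X - fps_const \<rho>) * E = fps_X"
  proof (rule fps_ext)
    fix n
    show "fps_nth ((fps_X - fps_const \<rho>) * E) n = fps_nth fps_X n"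
    proof (cases n)
      case (Suc m)
      then show ?thesis using \<rho>0 by (cases m) (simp_all add: E_def left_diff_distrib)
    qed (simp add: E_def left_diff_distrib)
  qed
  have lin: "fps_of_poly [:- \<rho>, 1:] = fps_X - fps_const \<rho>"
    by (simp add: fps_of_poly_pCons fps_const_neg[symmetric] del: fps_const_neg)
  show ?case
  proof (intro exI[of _ "A + E"] conjI allI)
    have "fps_X * fps_deriv (fps_of_poly T) = fps_X * fps_of_poly T1 + (fps_X - fps_const \<rho>) * (fps_X * fps_deriv (fps_of_poly T1))"
      unfolding T fps_of_poly_mult lin by (simp add: distrib_left mult_ac)
    also have "\<dots> = (fps_X - fps_const \<rho>) * fps_of_poly T1 * (A + E)"
    proof -
      have "fps_X * fps_of_poly T1 = ((fps_X - fps_const \<rho>) * E) * fps_of_poly T1" by (simp only: E)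
      then show ?thesis unfolding A by (simp only: distrib_left distrib_right mult_ac add_ac)
    qed
    finally show "fps_X * fps_deriv (fps_of_poly T) = fps_of_poly T * (A + E)"
      unfolding T fps_of_poly_mult lin .
    fix n
    have "norm (fps_nth E n) \<le> 1"
    proof -
      have "norm (1 / \<rho>) \<le> 1" using \<rho>1 by (simp add: norm_divide divide_le_eq)
      then have "norm ((1 / \<rho>) ^ n) \<le> 1" unfolding norm_power by (intro power_le_one) auto
      then show ?thesis by (simp add: E_def)
    qed
    then show "norm (fps_nth (A + E) n) \<le> real (degree T)"
      unfolding deg using A(2)[of n] norm_triangle_ineq[of "fps_nth A n" "fps_nth E n"] by simp
  qed
qed

text \<open>
  Taking a denominator of least degree plays the role of reducing the fraction to lowest terms.
\<close>

lemma bounded_log_derivative_rational: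
  fixes F A :: "complex fps" and P Q :: "complex poly"
  assumes R: "fps_conv_radius F \<ge> 1"
    and nz: "\<And>z. norm z < 1 \<Longrightarrow> eval_fps F z \<noteq> 0"
    and FA: "fps_X * fps_deriv F = F * A"
    and QF: "fps_of_poly Q * F = fps_of_poly P" and Q: "Q \<noteq> 0"
  shows "\<exists>C. \<forall>n. norm (fps_nth A n) \<le> C"
proof -
  define Z where "Z = (\<lambda>d. \<exists>P Q. fps_of_poly Q * F = fps_of_poly P \<and> Q \<noteq> 0 \<and> degree Q = d)"
  have "Z (degree Q)" using QF Q by (auto simp: Z_def)
  then have "Z (LEAST d. Z d)" by (rule LeastI)
  then obtain P Q where QF: "fps_of_poly Q * F = fps_of_poly P" and Q: "Q \<noteq> 0"
    and "degree Q = (LEAST d. Z d)" by (auto simp: Z_def)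
  then have least: "degree Q \<le> degree Q'" if "fps_of_poly Q' * F = fps_of_poly P'" "Q' \<noteq> 0" for P' Q'
    using Least_le[of Z "degree Q'"] that by (auto simp: Z_def)
  have PQ: "poly P z = poly Q z * eval_fps F z" if "norm z < 1" for z
  proof -
    have "ereal (norm z) < fps_conv_radius F" using R that by (simp add: less_le_trans[of _ "1::ereal"])
    then have "eval_fps (fps_of_poly Q * F) z = eval_fps (fps_of_poly Q) z * eval_fps F z"
      by (intro eval_fps_mult) auto
    then show ?thesis by (simp add: QF)
  qed
  have Qz: "poly Q z \<noteq> 0" if z: "norm z < 1" for z
  proof
    \<comment> \<open>\<open>F\<close> converges at \<open>z\<close>, so \<open>P\<close> vanishes
      there as well and the common factor cancels, against the minimality of
      \<open>degree Q\<close>.\<close>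
    assume 0: "poly Q z = 0"
    then have "poly P z = 0" using PQ[OF z] by simp
    obtain Q1 where Q1: "Q = [:- z, 1:] * Q1" using 0 unfolding poly_eq_0_iff_dvd by (elim dvdE)
    obtain P1 where P1: "P = [:- z, 1:] * P1" using \<open>poly P z = 0\<close> unfolding poly_eq_0_iff_dvd by (elim dvdE)
    note 1 = Q1 P1
    have "fps_of_poly [:- z, 1:] * (fps_of_poly Q1 * F) = fps_of_poly [:- z, 1:] * fps_of_poly P1"
      using QF unfolding 1 fps_of_poly_mult by (simp only: mult.assoc)
    moreover have "fps_of_poly [:- z, 1:] \<noteq> 0" by simp
    ultimately have "fps_of_poly Q1 * F = fps_of_poly P1"
      by (simp only: mult_cancel_left) simp
    moreover have "Q1 \<noteq> 0" "degree Q = Suc (degree Q1)"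
      using Q unfolding Q1 by (auto simp: degree_mult_eq simp del: mult_pCons_left)
    ultimately show False using least[of Q1 P1] by simp
  qed
  have Pz: "poly P z \<noteq> 0" if "norm z < 1" for z using PQ[OF that] Qz[OF that] nz[OF that] by simp
  then have "P \<noteq> 0" using Pz[of 0] by force
  obtain AP where AP: "fps_X * fps_deriv (fps_of_poly P) = fps_of_poly P * AP"
     "\<And>n. norm (fps_nth AP n) \<le> real (degree P)"
    using bounded_log_derivative_poly[OF \<open>P \<noteq> 0\<close> Pz] by blast
  obtain AQ where AQ: "fps_X * fps_deriv (fps_of_poly Q) = fps_of_poly Q * AQ"
     "\<And>n. norm (fps_nth AQ n) \<le> real (degree Q)"
    using bounded_log_derivative_poly[OF Q Qz] by blast
  \<comment> \<open>Logarithmic derivatives add up along \<open>P = Q * F\<close>, which expresses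
    \<open>A\<close> as the difference of two bounded sequences.\<close>
  have "fps_of_poly P * AP = fps_X * fps_deriv (fps_of_poly Q * F)" by (simp add: QF AP)
  also have "\<dots> = (fps_X * fps_deriv F) * fps_of_poly Q + F * (fps_X * fps_deriv (fps_of_poly Q))"
    by (simp add: distrib_left mult_ac)
  also have "\<dots> = (fps_of_poly Q * F) * (A + AQ)"
    unfolding FA AQ by (simp add: distrib_left mult_ac)
  also have "\<dots> = fps_of_poly P * (A + AQ)" by (simp only: QF)
  finally have "AP = A + AQ" using \<open>P \<noteq> 0\<close> by simp
  then have "A = AP - AQ" by simp
  then have "norm (fps_nth A n) \<le> real (degree P) + real (degree Q)" for n
    using AP(2)[of n] AQ(2)[of n] norm_triangle_ineq4[of "fps_nth AP n" "fps_nth AQ n"] by simp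
  then show ?thesis by blast
qed

text \<open>\<open>Q\<close> carries the relation in reverse order, so that from index
  \<open>N\<close> on every coefficient of \<open>Q * F\<close> is an instance of the
  relation.\<close>

lemma rational_of_linear_relations:
  fixes F :: "'a::comm_ring_1 fps" and q :: "nat \<Rightarrow> 'a"
  assumes q: "i0 < N" "q i0 \<noteq> 0" and rel: "\<And>j. (\<Sum>i<N. q i * fps_nth F (i + j)) = 0"
  shows "\<exists>P Q. Q \<noteq> 0 \<and> fps_of_poly Q * F = fps_of_poly P"
proof -
  define Q where "Q = (\<Sum>i<N. monom (q i) (N - 1 - i))"
  define P where "P = (\<Sum>n<N. monom (fps_nth (fps_of_poly Q * F) n) n)"
  have "coeff Q (N - 1 - i0) = (\<Sum>i\<in>{i0}. q i)"
    unfolding Q_def coeff_sum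
    by (rule sum.mono_neutral_cong_right) (use q in \<open>auto split: if_splits\<close>)
  then have "Q \<noteq> 0" using q by auto
  moreover have "fps_of_poly Q * F = fps_of_poly P"
  proof (rule fps_ext)
    fix n
    show "fps_nth (fps_of_poly Q * F) n = fps_nth (fps_of_poly P) n"
    proof (cases "n < N")
      case True
      then show ?thesis by (simp add: P_def coeff_sum)
    next
      case False
      have "fps_of_poly Q * F = (\<Sum>i<N. fps_const (q i) * (fps_X ^ (N - 1 - i) * F))"
        unfolding Q_def fps_of_poly_sum fps_of_poly_monom sum_distrib_right by (simp add: mult.assoc)
      also have "fps_nth \<dots> n = (\<Sum>i<N. q i * fps_nth F (i + (n - (N - 1))))"
        unfolding fps_sum_nth using False
        by (intro sum.cong refl) (auto simp: fps_X_power_mult_nth add.commute)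
      also have "\<dots> = 0" by (rule rel)
      finally show ?thesis using False by (simp add: P_def coeff_sum)
    qed
  qed
  ultimately show ?thesis by blast
qed

section \<open>Unboundedness of subgroup growth\<close>

text \<open>The index of \<open>L\<close> in a subgroup \<open>K\<close> appears below as the size
  of the image of \<open>K\<close> under \<open>\<lambda>a. L #> a\<close>. Indices are then
  compared by asking which elements two maps identify, without bijections between coset
  spaces.\<close>

lemma card_image_le_of_kernel:
  assumes "\<And>a b. a \<in> X \<Longrightarrow> b \<in> X \<Longrightarrow> f a = f b \<Longrightarrow> g a = g b"
    and "finite (f ` X)"
  shows "finite (g ` X) \<and> card (g ` X) \<le> card (f ` X)"
proof -
  have "g ` X = (\<lambda>y. g (inv_into X f y)) ` f ` X"
  proof -
    have "g (inv_into X f (f x)) = g x" if "x \<in> X" for x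
      using that by (intro assms(1)) (auto intro: inv_into_into f_inv_into_f)
    then show ?thesis by (simp add: image_image)
  qed
  then show ?thesis using assms(2) by (metis card_image_le finite_imageI)
qed

lemma card_image_eq_of_kernel:
  assumes "\<And>a b. a \<in> X \<Longrightarrow> b \<in> X \<Longrightarrow> f a = f b \<longleftrightarrow> g a = g b"
  shows "finite (f ` X) \<longleftrightarrow> finite (g ` X)" and "card (f ` X) = card (g ` X)"
proof -
  show fin: "finite (f ` X) \<longleftrightarrow> finite (g ` X)"
    using card_image_le_of_kernel[of X f g] card_image_le_of_kernel[of X g f] assms by blast
  show "card (f ` X) = card (g ` X)"
  proof (cases "finite (f ` X)")
    case True
    then show ?thesis
      using fin card_image_le_of_kernel[of X f g] card_image_le_of_kernel[of X g f] assms
      by (intro le_antisym) blast+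
  next
    case False
    then show ?thesis using fin by simp
  qed
qed

context group
begin

lemma rcos_eq_iff:
  assumes "subgroup L G" "a \<in> carrier G" "b \<in> carrier G"
  shows "L #> a = L #> b \<longleftrightarrow> a \<otimes> inv b \<in> L"
  using assms subgroup.rcos_module[OF assms(1) is_group assms(3,2)]
  by (metis rcos_self repr_independence)

lemma rcosets_eq_image: "rcosets L = (\<lambda>a. L #> a) ` carrier G"
  by (auto simp: RCOSETS_def)

lemma rcosets_restrict: "rcosets\<^bsub>G\<lparr>carrier := H\<rparr>\<^esub> L = (\<lambda>a. L #> a) ` H"
  by (auto simp: RCOSETS_def r_coset_def)

text \<open>The tower law: representatives \<open>r\<close> of the cosets of \<open>H\<close> carry
  the cosets of \<open>L\<close> inside \<open>H\<close> to all the others.\<close>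

lemma subgroup_index_mult:
  assumes H: "subgroup H G" and L: "subgroup L G" "L \<subseteq> H"
    and fin: "finite (rcosets H)" "finite ((\<lambda>a. L #> a) ` H)"
  shows "finite (rcosets L)" and "card (rcosets L) = card (rcosets H) * card ((\<lambda>a. L #> a) ` H)"
proof -
  define r where "r = (\<lambda>C. SOME a. a \<in> carrier G \<and> C = H #> a)"
  have r: "r C \<in> carrier G" "C = H #> r C" if "C \<in> rcosets H" for C
  proof -
    have "\<exists>a. a \<in> carrier G \<and> C = H #> a" using that by (auto simp: RCOSETS_def)
    then have "r C \<in> carrier G \<and> C = H #> r C" unfolding r_def by (rule someI_ex)
    then show "r C \<in> carrier G" "C = H #> r C" by auto
  qed
  have Hc: "h \<in> carrier G" if "h \<in> H" for h using that H by (rule subgroup.mem_carrier[rotated])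
  have coset: "L #> h #> g = L #> (h \<otimes> g)" if "h \<in> H" "g \<in> carrier G" for h g
    using that Hc subgroup.subset[OF L(1)] by (simp add: coset_mult_assoc)
  have "bij_betw (\<lambda>(C, D). D #> r C) ((rcosets H) \<times> (\<lambda>a. L #> a) ` H) (rcosets L)"
  proof (rule bij_betwI')
    fix x y assume "x \<in> (rcosets H) \<times> (\<lambda>a. L #> a) ` H" "y \<in> (rcosets H) \<times> (\<lambda>a. L #> a) ` H"
    then obtain C D h h' where x: "x = (C, L #> h)" "C \<in> rcosets H" "h \<in> H"
      and y: "y = (D, L #> h')" "D \<in> rcosets H" "h' \<in> H" by blast
    show "((case x of (C, D) \<Rightarrow> D #> r C) = (case y of (C, D) \<Rightarrow> D #> r C)) = (x = y)"
    proof
      assume "(case x of (C, D) \<Rightarrow> D #> r C) = (case y of (C, D) \<Rightarrow> D #> r C)"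
      then have "L #> (h \<otimes> r C) = L #> (h' \<otimes> r D)" using x y r coset by simp
      then have in_L: "(h \<otimes> r C) \<otimes> inv (h' \<otimes> r D) \<in> L"
        using x y r Hc L by (subst rcos_eq_iff[symmetric]) auto
      then have "(h \<otimes> r C) \<otimes> inv (h' \<otimes> r D) \<in> H" using L by auto
      then have "H #> (h \<otimes> r C) = H #> (h' \<otimes> r D)"
        using x y r Hc H by (subst rcos_eq_iff) auto
      moreover have "H #> (h \<otimes> r C) = H #> r C" "H #> (h' \<otimes> r D) = H #> r D"
        using x y r Hc H by (simp_all add: coset_join2 subgroup.subset flip: coset_mult_assoc)
      ultimately have "C = D" using r x y by metis
      moreover have "L #> h = L #> h'"
      proof -
        have "(h \<otimes> r C) \<otimes> inv (h' \<otimes> r C) = h \<otimes> inv h'"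
          using x y r Hc by (simp add: inv_mult_group m_assoc) (simp flip: m_assoc)
        then show ?thesis using in_L \<open>C = D\<close> x y Hc L by (subst rcos_eq_iff) auto
      qed
      ultimately show "x = y" using x y by simp
    qed simp
  next
    fix x assume "x \<in> (rcosets H) \<times> (\<lambda>a. L #> a) ` H"
    then obtain C h where x: "x = (C, L #> h)" "C \<in> rcosets H" "h \<in> H" by blast
    then show "(case x of (C, D) \<Rightarrow> D #> r C) \<in> rcosets L"
      using r[OF x(2)] coset Hc subgroup.subset[OF L(1)] by (simp add: rcosetsI)
  next
    fix E assume "E \<in> rcosets L"
    then obtain g where g: "g \<in> carrier G" "E = L #> g" by (auto simp: RCOSETS_def)
    define C where "C = H #> g"
    have C: "C \<in> rcosets H" using g by (auto simp: C_def RCOSETS_def)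
    have "g \<otimes> inv (r C) \<in> H" using r[OF C] g H by (metis C_def rcos_eq_iff)
    moreover have "g = (g \<otimes> inv (r C)) \<otimes> r C" using g r[OF C] by (simp add: m_assoc)
    ultimately have "E = (case (C, L #> (g \<otimes> inv (r C))) of (C, D) \<Rightarrow> D #> r C)"
      using g r[OF C] coset by simp
    with C \<open>g \<otimes> inv (r C) \<in> H\<close> show "\<exists>x\<in>(rcosets H) \<times> (\<lambda>a. L #> a) ` H. E = (case x of (C, D) \<Rightarrow> D #> r C)"
      by blast
  qed
  then have "finite (rcosets L) = finite ((rcosets H) \<times> (\<lambda>a. L #> a) ` H)"
    and "card ((rcosets H) \<times> (\<lambda>a. L #> a) ` H) = card (rcosets L)"
    by (simp_all add: bij_betw_finite bij_betw_same_card)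
  then show "finite (rcosets L)" and "card (rcosets L) = card (rcosets H) * card ((\<lambda>a. L #> a) ` H)"
    using fin by (auto simp: card_cartesian_product)
qed

text \<open>
  A subgroup of index \<open>n\<close> is determined by the action of the generators and their inverses on its
  \<open>n\<close> numbered cosets.
\<close>

lemma finite_subgroups_of_index:
  assumes X: "finite X" "X \<subseteq> carrier G" "generate G X = carrier G"
  shows "finite (subgroups_of_index G n)"
proof -
  define Y where "Y = X \<union> (\<lambda>x. inv x) ` X"
  have Y: "finite Y" "Y \<subseteq> carrier G" using X by (auto simp: Y_def)
  define e where "e = (\<lambda>L. SOME e. bij_betw e (rcosets L) {..<n})"
  have e: "bij_betw (e L) (rcosets L) {..<n}" if "L \<in> subgroups_of_index G n" for L
  proof -
    have "\<exists>e. bij_betw e (rcosets L) {..<n}"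
      using that ex_bij_betw_finite_nat[of "rcosets L"]
      by (auto simp: subgroups_of_index_def finite_index_subgroups_def subgroup_index_def atLeast0LessThan)
    then show ?thesis unfolding e_def by (rule someI_ex)
  qed
  define \<tau> where "\<tau> = (\<lambda>L. \<lambda>(i, s)\<in>{..<n} \<times> Y. e L (inv_into (rcosets L) (e L) i #> s))"
  \<comment> \<open>The action on the cosets determines \<open>L\<close> only up to conjugacy;
    recording the number of the coset \<open>L\<close> singles out the stabiliser.\<close>
  define code where "code = (\<lambda>L. (\<tau> L, e L L))"
  have sub: "subgroup L G" if "L \<in> subgroups_of_index G n" for L
    using that by (auto simp: subgroups_of_index_def finite_index_subgroups_def)
  have cos: "L #> a \<in> rcosets L" if "a \<in> carrier G" for L a using that by (auto simp: RCOSETS_def)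
  have L_cos: "L \<in> rcosets L" if "subgroup L G" for L
    using cos[of \<one> L] subgroup.subset[OF that] by (simp add: coset_mult_one)
  have e_less: "e L (L #> a) < n" if "L \<in> subgroups_of_index G n" "a \<in> carrier G" for L a
    using bij_betwE[OF e[OF that(1)]] cos[OF that(2)] by auto
  have \<tau>: "\<tau> L (e L (L #> a), s) = e L (L #> (a \<otimes> s))"
    if "L \<in> subgroups_of_index G n" "a \<in> carrier G" "s \<in> Y" for L a s
  proof -
    have "inv_into (rcosets L) (e L) (e L (L #> a)) = L #> a"
      using bij_betw_imp_inj_on[OF e[OF that(1)]] cos[OF that(2)] by (rule inv_into_f_f)
    then show ?thesis
      using that e_less[OF that(1,2)] Y subgroup.subset[OF sub[OF that(1)]]
      by (auto simp: \<tau>_def coset_mult_assoc)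
  qed
  have "code ` subgroups_of_index G n \<subseteq> ({..<n} \<times> Y \<rightarrow>\<^sub>E {..<n}) \<times> {..<n}"
  proof (rule image_subsetI)
    fix L assume L: "L \<in> subgroups_of_index G n"
    have "e L (inv_into (rcosets L) (e L) i #> s) < n" if "i < n" "s \<in> Y" for i s
    proof -
      have "inv_into (rcosets L) (e L) i \<in> rcosets L"
        using e[OF L] that by (metis bij_betw_def inv_into_into lessThan_iff)
      then obtain a where "a \<in> carrier G" "inv_into (rcosets L) (e L) i = L #> a" by (auto simp: RCOSETS_def)
      then show ?thesis using that Y L subgroup.subset[OF sub[OF L]] e_less[OF L, of "a \<otimes> s"]
        by (auto simp: coset_mult_assoc subset_iff)
    qed
    moreover have "e L L < n" using bij_betwE[OF e[OF L]] L_cos[OF sub[OF L]] by auto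
    ultimately show "code L \<in> ({..<n} \<times> Y \<rightarrow>\<^sub>E {..<n}) \<times> {..<n}"
      by (auto simp: code_def \<tau>_def)
  qed
  then have "finite (code ` subgroups_of_index G n)"
    by (rule finite_subset) (use Y in \<open>auto intro!: finite_PiE\<close>)
  moreover have "inj_on code (subgroups_of_index G n)"
  proof (rule inj_onI)
    fix L L' assume L: "L \<in> subgroups_of_index G n" and L': "L' \<in> subgroups_of_index G n" and "code L = code L'"
    then have eq: "\<tau> L = \<tau> L'" "e L L = e L' L'" by (auto simp: code_def)
    have step: "e L (L #> (a \<otimes> s)) = e L' (L' #> (a \<otimes> s))"
      if "e L (L #> a) = e L' (L' #> a)" "a \<in> carrier G" "s \<in> Y" for a s
      using \<tau>[OF L that(2,3)] \<tau>[OF L' that(2,3)] that(1) eq by simp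
    have gen: "e L (L #> (a \<otimes> g)) = e L' (L' #> (a \<otimes> g))"
      if "g \<in> generate G X" "e L (L #> a) = e L' (L' #> a)" "a \<in> carrier G" for g a
      using that
    proof (induction arbitrary: a rule: generate.induct)
      case one
      then show ?case by simp
    next
      case (incl h)
      then show ?case by (intro step) (auto simp: Y_def)
    next
      case (inv h)
      then show ?case by (intro step) (auto simp: Y_def)
    next
      case (eng h1 h2)
      have "h1 \<in> carrier G" "h2 \<in> carrier G" using eng.hyps X by auto
      moreover have "e L (L #> (a \<otimes> h1 \<otimes> h2)) = e L' (L' #> (a \<otimes> h1 \<otimes> h2))"
        using eng.IH(1)[OF eng.prems] eng.prems \<open>h1 \<in> carrier G\<close> by (intro eng.IH(2)) auto
      ultimately show ?case using eng.prems by (simp add: m_assoc)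
    qed
    have all: "e L (L #> g) = e L' (L' #> g)" if "g \<in> carrier G" for g
      using gen[of g \<one>] that X eq sub[OF L] sub[OF L'] by (simp add: coset_mult_one subgroup.subset)
    have mem: "g \<in> M \<longleftrightarrow> g \<in> carrier G \<and> e M (M #> g) = e M M" if M: "M \<in> subgroups_of_index G n" for M g
    proof -
      have "e M (M #> g) = e M M \<longleftrightarrow> M #> g = M" if "g \<in> carrier G"
        by (rule inj_on_eq_iff[OF bij_betw_imp_inj_on[OF e[OF M]] cos[OF that] L_cos[OF sub[OF M]]])
      then show ?thesis
        using sub[OF M] coset_join1[of M g] coset_join2[of g M] by (metis subgroup.mem_carrier)
    qed
    show "L = L'" using mem[OF L] mem[OF L'] all eq by auto
  qed
  ultimately show ?thesis by (rule finite_imageD)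
qed

section \<open>Infinite cyclic factors and finite generation\<close>

text \<open>Exponents of a generator of the factor are unique, since a period would make the factor
  finite. They form an integer coordinate \<open>\<phi>\<close>, which replaces arithmetic in the
  quotient from here on.\<close>

lemma infinite_cyclic_factor_hom:
  assumes H: "subgroup H G" and N: "K \<lhd> G\<lparr>carrier := H\<rparr>"
    and cyc: "infinite_cyclic_group (G\<lparr>carrier := H\<rparr> Mod K)"
  shows "\<exists>\<phi> :: 'a \<Rightarrow> int. (\<forall>a\<in>H. \<forall>b\<in>H. \<phi> (a \<otimes> b) = \<phi> a + \<phi> b) \<and> (\<exists>t\<in>H. \<phi> t = 1) \<and>
           K = {a \<in> H. \<phi> a = 0}"
proof -
  let ?H = "G\<lparr>carrier := H\<rparr>"
  let ?Q = "?H Mod K"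
  interpret N: normal K ?H by (rule N)
  interpret Q: group ?Q by (rule N.factorgroup_is_group)
  obtain x where x: "x \<in> carrier ?Q" "carrier ?Q = range (\<lambda>n::int. x [^]\<^bsub>?Q\<^esub> n)"
    using cyc unfolding infinite_cyclic_group_def Q.cyclic_group by blast
  have no_period: "x [^]\<^bsub>?Q\<^esub> d \<noteq> \<one>\<^bsub>?Q\<^esub>" if "d > 0" for d :: int
  proof
    assume d: "x [^]\<^bsub>?Q\<^esub> d = \<one>\<^bsub>?Q\<^esub>"
    have "carrier ?Q \<subseteq> (\<lambda>n::int. x [^]\<^bsub>?Q\<^esub> n) ` {0..<d}"
    proof
      fix y assume "y \<in> carrier ?Q"
      then obtain n where "y = x [^]\<^bsub>?Q\<^esub> (n::int)" using x by auto
      also have "\<dots> = x [^]\<^bsub>?Q\<^esub> (d * (n div d) + n mod d)" by simp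
      also have "\<dots> = x [^]\<^bsub>?Q\<^esub> (n mod d)"
        unfolding Q.int_pow_mult[OF x(1)] Q.int_pow_pow[OF x(1), symmetric] d
        using x(1) by (simp del: mult_FactGroup one_FactGroup)
      finally show "y \<in> (\<lambda>n::int. x [^]\<^bsub>?Q\<^esub> n) ` {0..<d}" using that by auto
    qed
    then show False using cyc finite_surj[of "{0..<d}"] unfolding infinite_cyclic_group_def by blast
  qed
  have inj: "m = n" if "x [^]\<^bsub>?Q\<^esub> m = x [^]\<^bsub>?Q\<^esub> n" for m n :: int
  proof -
    have "x [^]\<^bsub>?Q\<^esub> (m - n) = \<one>\<^bsub>?Q\<^esub>" "x [^]\<^bsub>?Q\<^esub> (n - m) = \<one>\<^bsub>?Q\<^esub>"
      unfolding Q.int_pow_diff[OF x(1)] that by (simp_all add: x(1) del: mult_FactGroup one_FactGroup)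
    then show ?thesis using no_period[of "m - n"] no_period[of "n - m"] by force
  qed
  define \<phi> where "\<phi> = (\<lambda>a. THE n. K #>\<^bsub>?H\<^esub> a = x [^]\<^bsub>?Q\<^esub> (n::int))"
  have cos: "K #>\<^bsub>?H\<^esub> a \<in> carrier ?Q" if "a \<in> H" for a
    using that by (auto simp: FactGroup_def RCOSETS_def)
  have \<phi>_eq: "\<phi> a = n" if "K #>\<^bsub>?H\<^esub> a = x [^]\<^bsub>?Q\<^esub> n" for a n
    unfolding \<phi>_def using that inj by (intro the_equality) auto
  have \<phi>: "K #>\<^bsub>?H\<^esub> a = x [^]\<^bsub>?Q\<^esub> \<phi> a" if "a \<in> H" for a
    using cos[OF that] x(2) \<phi>_eq by auto
  have "\<phi> (a \<otimes> b) = \<phi> a + \<phi> b" if "a \<in> H" "b \<in> H" for a b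
  proof (rule \<phi>_eq)
    have "K #>\<^bsub>?H\<^esub> (a \<otimes> b) = (K #>\<^bsub>?H\<^esub> a) \<otimes>\<^bsub>?Q\<^esub> (K #>\<^bsub>?H\<^esub> b)"
      using that N.rcos_sum[of a b] by (simp add: FactGroup_def)
    then show "K #>\<^bsub>?H\<^esub> (a \<otimes> b) = x [^]\<^bsub>?Q\<^esub> (\<phi> a + \<phi> b)"
      using \<phi> that x(1) by (simp add: Q.int_pow_mult)
  qed
  moreover have "\<exists>t\<in>H. \<phi> t = 1"
  proof -
    obtain t where "t \<in> H" "x = K #>\<^bsub>?H\<^esub> t" using x(1) by (auto simp: FactGroup_def RCOSETS_def)
    then show ?thesis using \<phi>_eq[of t 1] x(1) by (intro bexI[of _ t]) (auto simp: Q.int_pow_1)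
  qed
  moreover have "K = {a \<in> H. \<phi> a = 0}"
  proof -
    have K: "subgroup K ?H" by (rule N.is_subgroup)
    have one: "x [^]\<^bsub>?Q\<^esub> (0::int) = K" by (simp add: FactGroup_def)
    have "a \<in> K \<longleftrightarrow> \<phi> a = 0" if "a \<in> H" for a
    proof
      assume "a \<in> K"
      then have "K #>\<^bsub>?H\<^esub> a = K" using that K N.coset_join2[of a K] by simp
      then show "\<phi> a = 0" using \<phi>_eq[of a 0] one by simp
    next
      assume "\<phi> a = 0"
      then have "K #>\<^bsub>?H\<^esub> a = K" using \<phi>[OF that] one by simp
      then show "a \<in> K" using that K N.coset_join1[of K a] by simp
    qed
    moreover have "K \<subseteq> H" using subgroup.subset[OF K] by simp
    ultimately show ?thesis by auto
  qed
  ultimately show ?thesis by blast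
qed

lemma additive_pow:
  fixes \<phi> :: "'a \<Rightarrow> int"
  assumes H: "subgroup H G" and add: "\<forall>a\<in>H. \<forall>b\<in>H. \<phi> (a \<otimes> b) = \<phi> a + \<phi> b" and x: "x \<in> H"
  shows "\<phi> (inv x) = - \<phi> x" and "\<phi> (x [^] (n::int)) = n * \<phi> x" and "\<phi> \<one> = 0"
proof -
  interpret H: group "G\<lparr>carrier := H\<rparr>" by (rule subgroup.subgroup_is_group[OF H is_group])
  have hom: "\<phi> \<in> hom (G\<lparr>carrier := H\<rparr>) integer_group" using add by (auto simp: hom_def)
  interpret h: group_hom "G\<lparr>carrier := H\<rparr>" integer_group \<phi>
    by (intro group_hom.intro group_hom_axioms.intro H.is_group group_integer_group hom)
  show "\<phi> (inv x) = - \<phi> x" using h.hom_inv[of x] x H by (simp add: m_inv_consistent)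
  show "\<phi> (x [^] n) = n * \<phi> x" using h.hom_int_pow[of x n] x H int_pow_consistent[OF H x] by simp
  show "\<phi> \<one> = 0" using h.hom_one by simp
qed

text \<open>If \<open>t\<close> has value 1, then \<open>s \<otimes> t [^] (- \<phi> s)\<close> lies
  in the kernel \<open>S k\<close>, so each factor adds one generator. Finite generation is what
  makes the sets of subgroups of given index finite, both in the kernel \<open>K\<close> and in
  \<open>G\<close>.\<close>

lemma subnormal_series_finitely_generated:
  assumes "subnormal_series G infinite_cyclic_group H m S" "k \<le> m"
  shows "\<exists>X. finite X \<and> X \<subseteq> carrier G \<and> generate G X = S k"
  using assms(2)
proof (induction k)
  case 0
  then show ?case using assms(1) by (intro exI[of _ "{}"]) (auto simp: subnormal_series_def generate_empty)
next
  case (Suc k)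
  then obtain X where X: "finite X" "X \<subseteq> carrier G" "generate G X = S k" by auto
  have sub: "subgroup (S k) G" "subgroup (S (Suc k)) G"
    using assms(1) Suc.prems by (auto simp: subnormal_series_def)
  obtain \<phi> :: "'a \<Rightarrow> int" and t where add: "\<forall>a\<in>S (Suc k). \<forall>b\<in>S (Suc k). \<phi> (a \<otimes> b) = \<phi> a + \<phi> b"
    and t: "t \<in> S (Suc k)" "\<phi> t = 1" and K: "S k = {a \<in> S (Suc k). \<phi> a = 0}"
  proof -
    have "S k \<lhd> G\<lparr>carrier := S (Suc k)\<rparr>" "infinite_cyclic_group (G\<lparr>carrier := S (Suc k)\<rparr> Mod S k)"
      using assms(1) Suc.prems by (auto simp: subnormal_series_def)
    from infinite_cyclic_factor_hom[OF sub(2) this] show ?thesis using that by blast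
  qed
  note pow = additive_pow[OF sub(2) add]
  have tc: "t \<in> carrier G" using t sub by (auto dest: subgroup.mem_carrier)
  have gsub: "subgroup (generate G (insert t X)) G" using X tc by (intro generate_is_subgroup) auto
  have "generate G (insert t X) = S (Suc k)"
  proof
    have "X \<subseteq> S (Suc k)" using X K generate.incl by fastforce
    then show "generate G (insert t X) \<subseteq> S (Suc k)"
      using t sub by (intro generate_subgroup_incl) auto
    show "S (Suc k) \<subseteq> generate G (insert t X)"
    proof
      fix s assume s: "s \<in> S (Suc k)"
      define u where "u = s \<otimes> t [^] (- \<phi> s)"
      have tp: "t [^] (- \<phi> s) \<in> S (Suc k)" using t sub by (simp add: subgroup_int_pow_closed)
      have "u \<in> S k"
        using s tp sub pow[OF t(1)] t(2) K add by (simp add: u_def subgroup.m_closed)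
      then have "u \<in> generate G (insert t X)"
        using X mono_generate[of X "insert t X"] by auto
      moreover have "t [^] \<phi> s \<in> generate G (insert t X)"
        by (intro subgroup_int_pow_closed[OF gsub] generate.incl) auto
      ultimately have "u \<otimes> t [^] \<phi> s \<in> generate G (insert t X)" using gsub by (simp add: subgroup.m_closed)
      moreover have "u \<otimes> t [^] \<phi> s = s"
        using s sub tc by (simp add: u_def m_assoc subgroup.mem_carrier int_pow_neg)
      ultimately show "s \<in> generate G (insert t X)" by simp
    qed
  qed
  then show ?case using X tc by (intro exI[of _ "insert t X"]) auto
qed

lemma finite_index_finitely_generated:
  assumes H: "H \<in> finite_index_subgroups G" and X: "finite X" "X \<subseteq> carrier G" "generate G X = H"
  shows "\<exists>Y. finite Y \<and> Y \<subseteq> carrier G \<and> generate G Y = carrier G"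
proof -
  have sub: "subgroup H G" "finite ((\<lambda>a. H #> a) ` carrier G)"
    using H by (auto simp: finite_index_subgroups_def rcosets_eq_image)
  obtain R where R: "R \<subseteq> carrier G" "finite R" "(\<lambda>a. H #> a) ` carrier G = (\<lambda>a. H #> a) ` R"
    using finite_subset_image[OF sub(2) subset_refl] by auto
  have gsub: "subgroup (generate G (X \<union> R)) G" using X R by (intro generate_is_subgroup) auto
  have "g \<in> generate G (X \<union> R)" if g: "g \<in> carrier G" for g
  proof -
    obtain r where r: "r \<in> R" "H #> g = H #> r" using R(3) g by blast
    then have "g \<otimes> inv r \<in> H" using rcos_eq_iff[OF sub(1) g] R by auto
    then have "g \<otimes> inv r \<in> generate G (X \<union> R)" using X mono_generate[of X "X \<union> R"] by auto
    moreover have "r \<in> generate G (X \<union> R)" using r by (intro generate.incl) auto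
    ultimately have "g \<otimes> inv r \<otimes> r \<in> generate G (X \<union> R)" using gsub by (simp add: subgroup.m_closed)
    then show ?thesis using g r R by (simp add: m_assoc subset_iff)
  qed
  moreover have "generate G (X \<union> R) \<subseteq> carrier G" using gsub by (rule subgroup.subset)
  ultimately show ?thesis using X R by (intro exI[of _ "X \<union> R"]) auto
qed

text \<open>Supplies a subgroup of index exactly \<open>n\<close>: the intersection of all such
  subgroups is then over a nonempty family and has index at least \<open>n\<close>.\<close>

lemma finite_index_subgroup_of_integer_quotient:
  fixes \<psi> :: "'a \<Rightarrow> int"
  assumes K: "subgroup K G" and add: "\<forall>a\<in>K. \<forall>b\<in>K. \<psi> (a \<otimes> b) = \<psi> a + \<psi> b"
    and c: "c \<in> K" "\<psi> c = 1" and n: "n > 0"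
  defines "L \<equiv> {y \<in> K. int n dvd \<psi> y}"
  shows "subgroup L G" and "finite ((\<lambda>a. L #> a) ` K)" and "card ((\<lambda>a. L #> a) ` K) = n"
proof -
  note pow = additive_pow[OF K add]
  note Kc = subgroup.mem_carrier[OF K]
  show L: "subgroup L G"
    by (rule subgroupI)
       (use K c add pow subgroup.subset[OF K] in
         \<open>auto simp: L_def subgroup.m_closed subgroup.m_inv_closed intro!: exI[of _ "\<one>"] subgroup.one_closed\<close>)
  have ker: "L #> a = L #> b \<longleftrightarrow> \<psi> a mod int n = \<psi> b mod int n" if "a \<in> K" "b \<in> K" for a b
  proof -
    have "L #> a = L #> b \<longleftrightarrow> a \<otimes> inv b \<in> L" using that Kc L by (simp add: rcos_eq_iff)
    also have "\<dots> \<longleftrightarrow> int n dvd \<psi> a - \<psi> b"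
      using that K add pow(1)[OF that(2)] by (simp add: L_def subgroup.m_closed subgroup.m_inv_closed)
    finally show ?thesis by (simp add: mod_eq_dvd_iff)
  qed
  have "(\<lambda>a. \<psi> a mod int n) ` K = {0..<int n}"
  proof
    show "(\<lambda>a. \<psi> a mod int n) ` K \<subseteq> {0..<int n}" using n by auto
    show "{0..<int n} \<subseteq> (\<lambda>a. \<psi> a mod int n) ` K"
    proof
      fix i assume "i \<in> {0..<int n}"
      then show "i \<in> (\<lambda>a. \<psi> a mod int n) ` K"
        using subgroup_int_pow_closed[OF K c(1)] pow(2)[OF c(1), of i] c(2)
        by (intro image_eqI[of _ _ "c [^] i"]) auto
    qed
  qed
  then show "finite ((\<lambda>a. L #> a) ` K)" and "card ((\<lambda>a. L #> a) ` K) = n"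
    using card_image_eq_of_kernel[of K "\<lambda>a. L #> a" "\<lambda>a. \<psi> a mod int n", OF ker] by auto
qed

text \<open>
  Conjugation by \<open>H\<close> permutes the finitely many subgroups of index \<open>n\<close> of \<open>K\<close>, so their
  intersection is invariant.
\<close>

lemma exists_invariant_finite_index_subgroup:
  fixes \<psi> :: "'a \<Rightarrow> int"
  assumes H: "subgroup H G" and K: "subgroup K G"
    and conj: "\<And>h k. h \<in> H \<Longrightarrow> k \<in> K \<Longrightarrow> h \<otimes> k \<otimes> inv h \<in> K"
    and X: "finite X" "X \<subseteq> carrier G" "generate G X = K"
    and add: "\<forall>a\<in>K. \<forall>b\<in>K. \<psi> (a \<otimes> b) = \<psi> a + \<psi> b"
    and c: "c \<in> K" "\<psi> c = 1" and n: "n > 0"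
  shows "\<exists>N. subgroup N G \<and> N \<subseteq> K \<and> (\<forall>h\<in>H. \<forall>k\<in>N. h \<otimes> k \<otimes> inv h \<in> N) \<and>
           finite ((\<lambda>a. N #> a) ` K) \<and> n \<le> card ((\<lambda>a. N #> a) ` K)"
proof -
  note Kc = subgroup.mem_carrier[OF K]
  note Hc = subgroup.mem_carrier[OF H]
  define S where "S = {L. subgroup L G \<and> L \<subseteq> K \<and> finite ((\<lambda>a. L #> a) ` K) \<and> card ((\<lambda>a. L #> a) ` K) = n}"
  have "finite S"
  proof (rule finite_subset)
    interpret K: group "G\<lparr>carrier := K\<rparr>" by (rule subgroup.subgroup_is_group[OF K is_group])
    have XK: "X \<subseteq> K" using X(3) generate.incl[of _ X G] by auto
    show "finite (subgroups_of_index (G\<lparr>carrier := K\<rparr>) n)"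
      using X(1) XK generate_consistent[OF XK K] X(3) by (intro K.finite_subgroups_of_index[of X]) auto
    show "S \<subseteq> subgroups_of_index (G\<lparr>carrier := K\<rparr>) n"
      using subgroup_incl[OF _ K]
      by (auto simp: S_def subgroups_of_index_def finite_index_subgroups_def subgroup_index_def rcosets_restrict)
  qed
  define L where "L = {y \<in> K. int n dvd \<psi> y}"
  have LS: "L \<in> S"
    using finite_index_subgroup_of_integer_quotient[OF K add c n] by (auto simp: S_def L_def)
  have sub: "subgroup M G" if "M \<in> S" for M using that by (simp add: S_def)
  define N where "N = \<Inter>S"
  have N: "subgroup N G" unfolding N_def using LS sub by (intro subgroups_Inter) auto
  have NL: "N \<subseteq> L" using LS by (auto simp: N_def)
  \<comment> \<open>A coset of \<open>N\<close> is determined by its cosets modulo the members of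
    the finite set \<open>S\<close>, so \<open>N\<close> has finite index.\<close>
  have ker: "N #> a = N #> b \<longleftrightarrow> (\<lambda>M\<in>S. M #> a) = (\<lambda>M\<in>S. M #> b)" if "a \<in> K" "b \<in> K" for a b
  proof -
    have "N #> a = N #> b \<longleftrightarrow> (\<forall>M\<in>S. a \<otimes> inv b \<in> M)"
      using that Kc N by (simp add: rcos_eq_iff) (simp add: N_def)
    also have "\<dots> \<longleftrightarrow> (\<forall>M\<in>S. M #> a = M #> b)"
      using that Kc sub by (simp add: rcos_eq_iff)
    finally show ?thesis by (auto simp: restrict_def fun_eq_iff)
  qed
  have "(\<lambda>a. \<lambda>M\<in>S. M #> a) ` K \<subseteq> (\<Pi>\<^sub>E M\<in>S. (\<lambda>a. M #> a) ` K)" by auto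
  moreover have "finite (\<Pi>\<^sub>E M\<in>S. (\<lambda>a. M #> a) ` K)"
    using \<open>finite S\<close> by (intro finite_PiE) (auto simp: S_def)
  ultimately have "finite ((\<lambda>a. \<lambda>M\<in>S. M #> a) ` K)" by (rule finite_subset)
  then have finN: "finite ((\<lambda>a. N #> a) ` K)"
    using card_image_eq_of_kernel(1)[of K "\<lambda>a. N #> a" "\<lambda>a. \<lambda>M\<in>S. M #> a", OF ker] by simp
  have "card ((\<lambda>a. L #> a) ` K) \<le> card ((\<lambda>a. N #> a) ` K)"
    using card_image_le_of_kernel[of K "\<lambda>a. N #> a" "\<lambda>a. L #> a"] finN NL Kc sub[OF LS] N
    by (auto simp: rcos_eq_iff)
  then have cardN: "n \<le> card ((\<lambda>a. N #> a) ` K)" using LS by (simp add: S_def)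
  have "h \<otimes> k \<otimes> inv h \<in> N" if h: "h \<in> H" and k: "k \<in> N" for h k
  proof -
    have "h \<otimes> k \<otimes> inv h \<in> M" if M: "M \<in> S" for M
    proof -
      \<comment> \<open>The conjugate of \<open>M\<close> by \<open>inv h\<close>. It is again in
        \<open>S\<close>, so \<open>k\<close>, which lies in every member of \<open>S\<close>, lies
        in it.\<close>
      define M' where "M' = {y \<in> K. h \<otimes> y \<otimes> inv h \<in> M}"
      have mult: "h \<otimes> (a \<otimes> b) \<otimes> inv h = (h \<otimes> a \<otimes> inv h) \<otimes> (h \<otimes> b \<otimes> inv h)"
        if "a \<in> carrier G" "b \<in> carrier G" for a b
        using that Hc[OF h] by (simp add: m_assoc) (simp flip: m_assoc)
      have inve: "h \<otimes> inv a \<otimes> inv h = inv (h \<otimes> a \<otimes> inv h)" if "a \<in> carrier G" for a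
        using that Hc[OF h] by (simp add: inv_mult_group m_assoc)
      have M'_sub: "subgroup M' G"
      proof (rule subgroupI)
        show "M' \<subseteq> carrier G" using Kc by (auto simp: M'_def)
        have "\<one> \<in> M'" using Hc[OF h] subgroup.one_closed[OF K] subgroup.one_closed[OF sub[OF M]] by (simp add: M'_def)
        then show "M' \<noteq> {}" by auto
        show "inv a \<in> M'" if "a \<in> M'" for a
          using that K sub[OF M] Kc by (auto simp: M'_def inve subgroup.m_inv_closed)
        show "a \<otimes> b \<in> M'" if "a \<in> M'" "b \<in> M'" for a b
          using that K sub[OF M] Kc by (auto simp: M'_def mult subgroup.m_closed)
      qed
      have ker': "M' #> a = M' #> b \<longleftrightarrow> M #> (h \<otimes> a \<otimes> inv h) = M #> (h \<otimes> b \<otimes> inv h)"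
        if "a \<in> K" "b \<in> K" for a b
      proof -
        have "M' #> a = M' #> b \<longleftrightarrow> a \<otimes> inv b \<in> M'" using that Kc M'_sub by (simp add: rcos_eq_iff)
        also have "\<dots> \<longleftrightarrow> (h \<otimes> a \<otimes> inv h) \<otimes> inv (h \<otimes> b \<otimes> inv h) \<in> M"
          using that K Kc by (simp add: M'_def mult inve subgroup.m_closed subgroup.m_inv_closed)
        also have "\<dots> \<longleftrightarrow> M #> (h \<otimes> a \<otimes> inv h) = M #> (h \<otimes> b \<otimes> inv h)"
          using that Kc Hc[OF h] sub[OF M] by (simp add: rcos_eq_iff)
        finally show ?thesis .
      qed
      have "(\<lambda>a. M #> (h \<otimes> a \<otimes> inv h)) ` K = (\<lambda>a. M #> a) ` K"
      proof -
        have "(\<lambda>a. h \<otimes> a \<otimes> inv h) ` K = K"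
        proof
          show "(\<lambda>a. h \<otimes> a \<otimes> inv h) ` K \<subseteq> K" using conj[OF h] by auto
          show "K \<subseteq> (\<lambda>a. h \<otimes> a \<otimes> inv h) ` K"
          proof
            fix a assume a: "a \<in> K"
            have "inv h \<otimes> a \<otimes> inv (inv h) \<in> K" using a h H by (intro conj) (auto simp: subgroup.m_inv_closed)
            moreover have "a = h \<otimes> (inv h \<otimes> a \<otimes> inv (inv h)) \<otimes> inv h"
              using a Kc Hc[OF h] by (simp add: m_assoc) (simp flip: m_assoc)
            ultimately show "a \<in> (\<lambda>a. h \<otimes> a \<otimes> inv h) ` K" by (rule image_eqI[rotated])
          qed
        qed
        then show ?thesis by (metis image_image)
      qed
      then have "M' \<in> S"
        using card_image_eq_of_kernel[of K "\<lambda>a. M' #> a" "\<lambda>a. M #> (h \<otimes> a \<otimes> inv h)", OF ker'] M M'_sub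
        by (auto simp: S_def M'_def)
      then show ?thesis using k by (auto simp: N_def M'_def)
    qed
    then show ?thesis by (simp add: N_def)
  qed
  moreover have "N \<subseteq> K" using NL by (auto simp: L_def)
  ultimately show ?thesis using N finN cardN by blast
qed

text \<open>
  The subgroups counted here are the complements of \<open>K / N\<close> in \<open>H / N\<close> that are generated by the
  elements of \<open>\<phi>\<close>-value \<open>1\<close>.
\<close>

lemma many_subgroups_of_index:
  fixes \<phi> :: "'a \<Rightarrow> int"
  assumes H: "subgroup H G" "finite (rcosets H)"
    and add: "\<forall>a\<in>H. \<forall>b\<in>H. \<phi> (a \<otimes> b) = \<phi> a + \<phi> b" and t: "t \<in> H" "\<phi> t = 1"
  defines "K \<equiv> {a \<in> H. \<phi> a = 0}"
  assumes N: "subgroup N G" "N \<subseteq> K" and conj: "\<And>h k. h \<in> H \<Longrightarrow> k \<in> N \<Longrightarrow> h \<otimes> k \<otimes> inv h \<in> N"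
    and fin: "finite ((\<lambda>a. N #> a) ` K)"
    and finG: "finite (subgroups_of_index G (card (rcosets H) * card ((\<lambda>a. N #> a) ` K)))"
  shows "card ((\<lambda>a. N #> a) ` K) \<le> subgroup_count G (card (rcosets H) * card ((\<lambda>a. N #> a) ` K))"
proof -
  define k where "k = card ((\<lambda>a. N #> a) ` K)"
  note pow = additive_pow[OF H(1) add]
  note Hc = subgroup.mem_carrier[OF H(1)]
  note Hm = subgroup.m_closed[OF H(1)] subgroup.m_inv_closed[OF H(1)] subgroup_int_pow_closed[OF H(1)]
  have KH: "K \<subseteq> H" by (auto simp: K_def)
  have K_diff: "a \<otimes> inv b \<in> K" if "a \<in> H" "b \<in> H" "\<phi> a = \<phi> b" for a b
    using that add pow(1)[OF that(2)] Hm by (simp add: K_def)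
  \<comment> \<open>For \<open>\<phi> x = 1\<close> this is the group generated by \<open>N\<close>
    and \<open>x\<close>: the elements that agree modulo \<open>N\<close> with the power of
    \<open>x\<close> of the same \<open>\<phi>\<close>-value.\<close>
  define C where "C = (\<lambda>x. {h \<in> H. h \<otimes> inv (x [^] \<phi> h) \<in> N})"
  have C_sub: "subgroup (C x) G" and C_index: "finite ((\<lambda>a. C x #> a) ` H)" "card ((\<lambda>a. C x #> a) ` H) = k"
    and C_x: "x \<in> C x" if x: "x \<in> H" "\<phi> x = 1" for x
  proof -
    show C_sub: "subgroup (C x) G"
    proof (rule subgroupI)
      show "C x \<subseteq> carrier G" using Hc by (auto simp: C_def)
      show "C x \<noteq> {}"
        using subgroup.one_closed[OF H(1)] subgroup.one_closed[OF N(1)] pow(3)[OF x(1)]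
        by (auto simp: C_def intro!: exI[of _ \<one>])
      fix a assume a: "a \<in> C x"
      define u where "u = a \<otimes> inv (x [^] \<phi> a)"
      have aH: "a \<in> H" and u: "u \<in> N" using a by (auto simp: C_def u_def)
      have ac: "a \<in> carrier G" "x [^] \<phi> a \<in> carrier G" using aH Hc x by auto
      have "inv (x [^] \<phi> a) \<otimes> inv u \<otimes> inv (inv (x [^] \<phi> a)) \<in> N"
        using x Hm u N by (intro conj) (auto simp: subgroup.m_inv_closed)
      also have "inv (x [^] \<phi> a) \<otimes> inv u \<otimes> inv (inv (x [^] \<phi> a)) = inv a \<otimes> inv (x [^] \<phi> (inv a))"
      proof -
        have "inv (x [^] \<phi> (inv a)) = x [^] \<phi> a" using pow(1)[OF aH] x Hc by (simp add: int_pow_neg)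
        then show ?thesis using ac by (simp add: u_def inv_mult_group) (simp flip: m_assoc)
      qed
      finally show "inv a \<in> C x" using aH Hm by (simp add: C_def)
      fix b assume b: "b \<in> C x"
      define v where "v = b \<otimes> inv (x [^] \<phi> b)"
      have bH: "b \<in> H" and v: "v \<in> N" using b by (auto simp: C_def v_def)
      have bc: "b \<in> carrier G" "x [^] \<phi> b \<in> carrier G" using bH Hc x by auto
      have "u \<otimes> (x [^] \<phi> a \<otimes> v \<otimes> inv (x [^] \<phi> a)) \<in> N"
        using conj[OF _ v] u N Hm x by (simp add: subgroup.m_closed)
      also have "u \<otimes> (x [^] \<phi> a \<otimes> v \<otimes> inv (x [^] \<phi> a)) = (a \<otimes> b) \<otimes> inv (x [^] \<phi> (a \<otimes> b))"
      proof -
        have "\<phi> (a \<otimes> b) = \<phi> a + \<phi> b" using add aH bH by simp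
        then have "inv (x [^] \<phi> (a \<otimes> b)) = inv (x [^] \<phi> b) \<otimes> inv (x [^] \<phi> a)"
          using x Hc ac bc by (simp add: int_pow_mult inv_mult_group)
        moreover have "u \<otimes> (x [^] \<phi> a \<otimes> v \<otimes> inv (x [^] \<phi> a)) = (u \<otimes> x [^] \<phi> a) \<otimes> v \<otimes> inv (x [^] \<phi> a)"
        proof -
          have "u \<in> carrier G" "v \<in> carrier G" using ac bc by (auto simp: u_def v_def)
          then show ?thesis using ac bc by (simp add: m_assoc)
        qed
        moreover have "u \<otimes> x [^] \<phi> a = a" using ac by (simp add: u_def m_assoc)
        ultimately show ?thesis using ac bc by (simp add: v_def m_assoc)
      qed
      finally show "a \<otimes> b \<in> C x" using aH bH Hm by (simp add: C_def)
    qed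
    show "x \<in> C x" using x Hc subgroup.one_closed[OF N(1)] by (simp add: C_def)
    have xp: "x [^] i \<in> C x" for i :: int using \<open>x \<in> C x\<close> C_sub by (intro subgroup_int_pow_closed)
    \<comment> \<open>Powers of \<open>x\<close> move representatives of all cosets of
      \<open>C x\<close> into \<open>K\<close>, and \<open>C x\<close> meets \<open>K\<close> in
      \<open>N\<close>; so the index of \<open>C x\<close> in \<open>H\<close> is that of
      \<open>N\<close> in \<open>K\<close>.\<close>
    have "(\<lambda>a. C x #> a) ` H = (\<lambda>a. C x #> a) ` K"
    proof
      show "(\<lambda>a. C x #> a) ` K \<subseteq> (\<lambda>a. C x #> a) ` H" using KH by auto
      show "(\<lambda>a. C x #> a) ` H \<subseteq> (\<lambda>a. C x #> a) ` K"
      proof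
        fix E assume "E \<in> (\<lambda>a. C x #> a) ` H"
        then obtain a where a: "a \<in> H" "E = C x #> a" by auto
        define b where "b = inv (x [^] \<phi> a) \<otimes> a"
        have "b \<in> K" using a x Hm add pow(1)[of "x [^] \<phi> a"] pow(2)[OF x(1)] by (simp add: K_def b_def)
        moreover have "a \<otimes> inv b = x [^] \<phi> a"
          using a x Hc by (simp add: b_def inv_mult_group) (simp flip: m_assoc)
        then have "C x #> a = C x #> b"
          using rcos_eq_iff[OF C_sub, of a b] xp a x Hc Hm by (simp add: b_def)
        ultimately show "E \<in> (\<lambda>a. C x #> a) ` K" using a by auto
      qed
    qed
    moreover have "C x #> a = C x #> b \<longleftrightarrow> N #> a = N #> b" if "a \<in> K" "b \<in> K" for a b
    proof -
      have ab: "a \<in> H" "b \<in> H" "\<phi> a = \<phi> b" using that by (auto simp: K_def)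
      then have "a \<otimes> inv b \<in> K" by (rule K_diff)
      then have "a \<otimes> inv b \<in> C x \<longleftrightarrow> a \<otimes> inv b \<in> N" using ab Hc by (simp add: C_def K_def)
      then show ?thesis using ab Hc C_sub N by (simp add: rcos_eq_iff)
    qed
    ultimately show "finite ((\<lambda>a. C x #> a) ` H)" "card ((\<lambda>a. C x #> a) ` H) = k"
      using card_image_eq_of_kernel[of K "\<lambda>a. C x #> a" "\<lambda>a. N #> a"] fin by (auto simp: k_def)
  qed
  have yt: "y \<otimes> t \<in> H" "\<phi> (y \<otimes> t) = 1" if "y \<in> K" for y
    using that t add Hm by (auto simp: K_def)
  have C_in: "(\<lambda>y. C (y \<otimes> t)) ` K \<subseteq> subgroups_of_index G (card (rcosets H) * k)"
  proof (rule image_subsetI)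
    fix y assume y: "y \<in> K"
    have "C (y \<otimes> t) \<subseteq> H" by (auto simp: C_def)
    then show "C (y \<otimes> t) \<in> subgroups_of_index G (card (rcosets H) * k)"
      using subgroup_index_mult[OF H(1) C_sub[OF yt[OF y]] _ H(2) C_index(1)[OF yt[OF y]]] C_sub[OF yt[OF y]] C_index(2)[OF yt[OF y]]
      by (simp add: subgroups_of_index_def finite_index_subgroups_def subgroup_index_def)
  qed
  \<comment> \<open>Two elements of value 1 in the same \<open>C x\<close> differ by an element of
    \<open>N\<close>. So distinct cosets of \<open>N\<close> in \<open>K\<close> yield distinct
    subgroups.\<close>
  have ker: "N #> a = N #> b" if ab: "a \<in> K" "b \<in> K" "C (a \<otimes> t) = C (b \<otimes> t)" for a b
  proof -
    have "a \<otimes> t \<in> C (b \<otimes> t)" using C_x[OF yt[OF ab(1)]] ab(3) by simp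
    then have "(a \<otimes> t) \<otimes> inv (b \<otimes> t) \<in> N" using yt[OF ab(1)] yt[OF ab(2)] Hc by (simp add: C_def)
    also have "(a \<otimes> t) \<otimes> inv (b \<otimes> t) = a \<otimes> inv b"
      using ab KH t Hc by (simp add: inv_mult_group m_assoc subset_iff) (simp flip: m_assoc)
    finally show ?thesis using ab KH Hc N by (simp add: rcos_eq_iff subset_iff)
  qed
  have finG: "finite (subgroups_of_index G (card (rcosets H) * k))" using finG by (simp only: k_def)
  then have fin_C: "finite ((\<lambda>y. C (y \<otimes> t)) ` K)" by (rule finite_subset[OF C_in])
  have "k \<le> card ((\<lambda>y. C (y \<otimes> t)) ` K)"
    using card_image_le_of_kernel[of K "\<lambda>y. C (y \<otimes> t)" "\<lambda>a. N #> a", OF ker fin_C] by (simp only: k_def)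
  also have "\<dots> \<le> subgroup_count G (card (rcosets H) * k)"
    unfolding subgroup_count_def by (rule card_mono[OF finG C_in])
  finally show ?thesis by (simp only: k_def)
qed

theorem subgroup_count_unbounded:
  assumes "has_hirsch_length G m" "m \<ge> 2"
  shows "\<exists>n. C < subgroup_count G n"
proof -
  obtain H S where HG: "H \<in> finite_index_subgroups G" and S: "subnormal_series G infinite_cyclic_group H m S"
    using assms unfolding has_hirsch_length_def by blast
  \<comment> \<open>The top factor of the series gives \<open>\<phi>\<close> on \<open>H\<close>;
    the one below it gives \<open>\<psi>\<close> on the kernel of \<open>\<phi>\<close>, and with it
    subgroups of arbitrarily large index there.\<close>
  obtain j where m: "m = Suc (Suc j)" using assms(2) by (metis Suc_le_D numeral_2_eq_2 Suc_le_mono)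
  have sub: "subgroup (S (Suc j)) G" "subgroup (S m) G" and Sm: "S m = H" "subgroup H G"
    using S by (auto simp: subnormal_series_def m)
  have "S j \<lhd> G\<lparr>carrier := S (Suc j)\<rparr>" "infinite_cyclic_group (G\<lparr>carrier := S (Suc j)\<rparr> Mod S j)"
     "S (Suc j) \<lhd> G\<lparr>carrier := H\<rparr>" "infinite_cyclic_group (G\<lparr>carrier := H\<rparr> Mod S (Suc j))"
    using S by (auto simp: subnormal_series_def m)
  then obtain \<phi> \<psi> :: "'a \<Rightarrow> int" and t c where
    \<phi>: "\<forall>a\<in>H. \<forall>b\<in>H. \<phi> (a \<otimes> b) = \<phi> a + \<phi> b" "t \<in> H" "\<phi> t = 1" "S (Suc j) = {a \<in> H. \<phi> a = 0}" and
    \<psi>: "\<forall>a\<in>S (Suc j). \<forall>b\<in>S (Suc j). \<psi> (a \<otimes> b) = \<psi> a + \<psi> b" "c \<in> S (Suc j)" "\<psi> c = 1"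
    using infinite_cyclic_factor_hom[OF sub(1), of "S j"] infinite_cyclic_factor_hom[OF Sm(2), of "S (Suc j)"]
    by blast
  obtain X where X: "finite X" "X \<subseteq> carrier G" "generate G X = S (Suc j)"
    using subnormal_series_finitely_generated[OF S, of "Suc j"] m by auto
  obtain Y where "finite Y" "Y \<subseteq> carrier G" "generate G Y = H"
    using subnormal_series_finitely_generated[OF S, of m] Sm by auto
  then obtain Z where Z: "finite Z" "Z \<subseteq> carrier G" "generate G Z = carrier G"
    using finite_index_finitely_generated[OF HG] by blast
  note pow = additive_pow[OF Sm(2) \<phi>(1)]
  have conj: "h \<otimes> k \<otimes> inv h \<in> S (Suc j)" if "h \<in> H" "k \<in> S (Suc j)" for h k
    using that \<phi> Sm pow(1)[OF that(1)] by (auto simp: subgroup.m_closed subgroup.m_inv_closed)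
  obtain N where N: "subgroup N G" "N \<subseteq> S (Suc j)" "\<forall>h\<in>H. \<forall>k\<in>N. h \<otimes> k \<otimes> inv h \<in> N"
     "finite ((\<lambda>a. N #> a) ` S (Suc j))" "Suc C \<le> card ((\<lambda>a. N #> a) ` S (Suc j))"
    using exists_invariant_finite_index_subgroup[OF Sm(2) sub(1) conj X \<psi>, of "Suc C"] by auto
  have fin: "finite (rcosets H)" using HG by (auto simp: finite_index_subgroups_def)
  have "card ((\<lambda>a. N #> a) ` S (Suc j)) \<le> subgroup_count G (card (rcosets H) * card ((\<lambda>a. N #> a) ` S (Suc j)))"
    unfolding \<phi>(4)
    by (rule many_subgroups_of_index[OF Sm(2) fin \<phi>(1-3)])
       (use N \<phi>(4) finite_subgroups_of_index[OF Z] in auto)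
  then show ?thesis using N(5) by (meson Suc_le_lessD le_trans order_less_le_trans)
qed

end

section \<open>Euler products and the full shift\<close>

text \<open>In characteristic 0 the series \<open>F\<close> is determined by \<open>A\<close> and
  its constant term. Series are therefore compared through logarithmic derivatives, by induction on
  the coefficient, in place of formal logarithms and infinite products.\<close>

lemma log_derivative_coeff_recursion:
  fixes F A :: "'a::comm_ring_1 fps"
  assumes "fps_X * fps_deriv F = F * A" and "fps_nth A 0 = 0"
  shows "of_nat n * fps_nth F n = (\<Sum>i<n. fps_nth F i * fps_nth A (n - i))"
proof -
  have "of_nat n * fps_nth F n = fps_nth (fps_X * fps_deriv F) n" by (cases n) auto
  also have "\<dots> = (\<Sum>i\<le>n. fps_nth F i * fps_nth A (n - i))"
    unfolding assms(1) fps_mult_nth by (simp add: atLeast0AtMost)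
  also have "\<dots> = (\<Sum>i<n. fps_nth F i * fps_nth A (n - i))"
    using assms(2) by (simp flip: lessThan_Suc_atMost)
  finally show ?thesis .
qed

lemma fps_log_derivative_exp:
  fixes h :: "'a::field_char_0 fps"
  assumes "fps_nth h 0 = 0"
  shows "fps_X * fps_deriv (fps_exp 1 oo h) = (fps_exp 1 oo h) * (fps_X * fps_deriv h)"
  using assms by (simp add: fps_compose_deriv mult_ac)

lemma fps_log_derivative_mult:
  fixes E F :: "'a::comm_ring_1 fps"
  assumes "fps_X * fps_deriv E = E * A" "fps_X * fps_deriv F = F * B"
  shows "fps_X * fps_deriv (E * F) = (E * F) * (A + B)"
proof -
  have "fps_X * fps_deriv (E * F) = (fps_X * fps_deriv E) * F + E * (fps_X * fps_deriv F)"
    by (simp add: distrib_left mult_ac)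
  then show ?thesis unfolding assms by (simp add: distrib_left mult_ac)
qed

lemma fps_log_derivative_power:
  fixes E :: "'a::comm_ring_1 fps"
  assumes "fps_X * fps_deriv E = E * A"
  shows "fps_X * fps_deriv (E ^ n) = E ^ n * (of_nat n * A)"
proof (induction n)
  case (Suc n)
  show ?case using fps_log_derivative_mult[OF assms Suc] by (simp add: algebra_simps)
qed simp

text \<open>\<open>G\<close> is the geometric series \<open>1 / (1 - X ^ d)\<close>, and
  \<open>d * (G - 1)\<close> has coefficient \<open>d\<close> at each positive multiple of
  \<open>d\<close>. Powers of \<open>G\<close> serve the values \<open>\<beta> d \<ge> 0\<close>,
  powers of \<open>1 - X ^ d\<close> the negative ones, so that all exponents are natural numbers
  and all coefficients integers.\<close>

lemma fps_divisor_indicator: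
  fixes d :: nat
  defines "G \<equiv> Abs_fps (\<lambda>n. if d dvd n then 1 else 0 :: int)"
  assumes d: "d > 0"
  shows "(1 - fps_X ^ d) * G = 1" and "fps_X * fps_deriv G = G * (of_nat d * (G - 1))"
    and "fps_X * fps_deriv (1 - fps_X ^ d) = (1 - fps_X ^ d) * (- (of_nat d * (G - 1)))"
proof -
  show DG: "(1 - fps_X ^ d) * G = 1"
  proof (rule fps_ext)
    fix n
    have "fps_nth ((1 - fps_X ^ d) * G) n = fps_nth G n - (if n < d then 0 else fps_nth G (n - d))"
      by (simp add: left_diff_distrib fps_X_power_mult_nth)
    also have "\<dots> = (if n = 0 then 1 else 0)"
      using d by (auto simp: G_def dvd_minus_self dest: dvd_imp_le)
    finally show "fps_nth ((1 - fps_X ^ d) * G) n = fps_nth 1 n" by simp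
  qed
  have "G - fps_X ^ d * G = 1" using DG by (simp add: left_diff_distrib)
  then have XG: "fps_X ^ d * G = G - 1" by (metis add_diff_cancel_left' diff_add_cancel)
  have XD: "fps_X * fps_deriv (1 - fps_X ^ d :: int fps) = - (of_nat d * fps_X ^ d)"
  proof -
    have "fps_X * fps_deriv (1 - fps_X ^ d :: int fps) = - (of_nat d * (fps_X * fps_X ^ (d - 1)))"
      by (simp add: fps_deriv_power mult_ac fps_of_nat)
    also have "fps_X * fps_X ^ (d - 1) = (fps_X ^ d :: int fps)"
      using d by (cases d) auto
    finally show ?thesis .
  qed
  have "(1 - fps_X ^ d) * (G - 1) = fps_X ^ d" using DG by (simp add: right_diff_distrib)
  then show "fps_X * fps_deriv (1 - fps_X ^ d) = (1 - fps_X ^ d) * (- (of_nat d * (G - 1)))"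
    unfolding XD by (metis mult.left_commute mult_minus_right)
  have "0 = fps_X * fps_deriv ((1 - fps_X ^ d) * G)" unfolding DG by simp
  also have "\<dots> = (fps_X * fps_deriv (1 - fps_X ^ d)) * G + (1 - fps_X ^ d) * (fps_X * fps_deriv G)"
    by (simp only: fps_deriv_mult distrib_left mult_ac add_ac)
  finally have "(1 - fps_X ^ d) * (fps_X * fps_deriv G) = of_nat d * (fps_X ^ d * G)"
    unfolding XD by (simp add: mult_ac)
  then have "((1 - fps_X ^ d) * G) * (fps_X * fps_deriv G) = G * (of_nat d * (fps_X ^ d * G))"
    by (metis mult.assoc mult.commute)
  then show "fps_X * fps_deriv G = G * (of_nat d * (G - 1))" unfolding DG XG by simp
qed

text \<open>The truncated Euler product \<open>\<Prod>d\<le>N. (1 - X ^ d) powi (- \<beta> d)\<close>.\<close>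

lemma exists_integer_euler_product:
  fixes \<beta> :: "nat \<Rightarrow> int"
  shows "\<exists>P A. fps_nth P 0 = 1 \<and> fps_X * fps_deriv P = P * A \<and>
           (\<forall>n. fps_nth A n = (if n = 0 then 0 else \<Sum>d | d \<in> {1..N} \<and> d dvd n. int d * \<beta> d))"
proof (induction N)
  case 0
  show ?case by (intro exI[of _ 1] exI[of _ 0]) auto
next
  case (Suc N)
  then obtain P A where P: "fps_nth P 0 = 1" "fps_X * fps_deriv P = P * A"
    and A: "\<And>n. fps_nth A n = (if n = 0 then 0 else \<Sum>d | d \<in> {1..N} \<and> d dvd n. int d * \<beta> d)" by blast
  define d where "d = Suc N"
  define G where "G = Abs_fps (\<lambda>n. if d dvd n then 1 else 0 :: int)"
  have "d > 0" by (simp add: d_def)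
  note G = fps_divisor_indicator[OF this, folded G_def]
  have "\<exists>E. fps_nth E 0 = 1 \<and> fps_X * fps_deriv E = E * (of_int (\<beta> d) * (of_nat d * (G - 1)))"
  proof (cases "\<beta> d \<ge> 0")
    case True
    then show ?thesis
      using fps_log_derivative_power[OF G(2), of "nat (\<beta> d)"]
      by (intro exI[of _ "G ^ nat (\<beta> d)"]) (simp add: fps_power_zeroth G_def of_nat_nat)
  next
    case False
    then show ?thesis
      using fps_log_derivative_power[OF G(3), of "nat (- \<beta> d)"] \<open>d > 0\<close>
      by (intro exI[of _ "(1 - fps_X ^ d) ^ nat (- \<beta> d)"]) (simp add: fps_power_zeroth of_nat_nat zero_power)
  qed
  then obtain E where E: "fps_nth E 0 = 1" "fps_X * fps_deriv E = E * (of_int (\<beta> d) * (of_nat d * (G - 1)))" by blast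
  show ?case
  proof (intro exI conjI allI)
    show "fps_X * fps_deriv (P * E) = (P * E) * (A + of_int (\<beta> d) * (of_nat d * (G - 1)))"
      by (rule fps_log_derivative_mult[OF P(2) E(2)])
    show "fps_nth (P * E) 0 = 1" using P E by simp
    fix n
    have "of_int (\<beta> d) * (of_nat d * (G - 1)) = fps_const (int d * \<beta> d) * (G - 1)"
      by (simp add: fps_of_int[symmetric] fps_of_nat[symmetric] mult_ac flip: fps_const_mult)
    then have "fps_nth (A + of_int (\<beta> d) * (of_nat d * (G - 1))) n = fps_nth A n + int d * \<beta> d * fps_nth (G - 1) n"
      by simp
    also have "\<dots> = (if n = 0 then 0 else \<Sum>d | d \<in> {1..Suc N} \<and> d dvd n. int d * \<beta> d)"
    proof (cases "n = 0")
      case False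
      define S where "S = {d. d \<in> {1..N} \<and> d dvd n}"
      have "{d. d \<in> {1..Suc N} \<and> d dvd n} = (if d dvd n then insert d S else S)"
        by (auto simp: S_def d_def le_Suc_eq)
      moreover have "finite S" "d \<notin> S" by (auto simp: S_def d_def)
      ultimately have "(\<Sum>d | d \<in> {1..Suc N} \<and> d dvd n. int d * \<beta> d) =
          (\<Sum>d\<in>S. int d * \<beta> d) + (if d dvd n then int d * \<beta> d else 0)" by simp
      then show ?thesis using False A[of n] by (simp add: G_def S_def)
    qed (simp add: A G_def)
    finally show "fps_nth (A + of_int (\<beta> d) * (of_nat d * (G - 1))) n =
        (if n = 0 then 0 else \<Sum>d | d \<in> {1..Suc N} \<and> d dvd n. int d * \<beta> d)" .
  qed
qed

text \<open>The coefficients of \<open>F\<close> up to \<open>N\<close> depend on \<open>A\<close>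
  only up to \<open>N\<close>, where \<open>A\<close> agrees with the logarithmic derivative of the
  Euler product truncated at \<open>N\<close>. So a finite integer product suffices for each
  \<open>N\<close>.\<close>

lemma integer_coeffs_of_log_derivative:
  fixes F A :: "'a::field_char_0 fps" and \<beta> :: "nat \<Rightarrow> int"
  assumes F: "fps_X * fps_deriv F = F * A" "fps_nth F 0 = 1" and A0: "fps_nth A 0 = 0"
    and A: "\<And>n. n > 0 \<Longrightarrow> fps_nth A n = of_int (\<Sum>d | d dvd n. int d * \<beta> d)"
  shows "fps_nth F N \<in> \<int>"
proof -
  obtain P B where P: "fps_nth P 0 = 1" "fps_X * fps_deriv P = P * B"
    and B: "\<And>n. fps_nth B n = (if n = 0 then 0 else \<Sum>d | d \<in> {1..N} \<and> d dvd n. int d * \<beta> d)"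
    using exists_integer_euler_product[where N = N and \<beta> = \<beta>] by blast
  have AB: "fps_nth A n = of_int (fps_nth B n)" if "n \<le> N" for n
  proof (cases "n = 0")
    case False
    have "{d. d dvd n} = {d. d \<in> {1..N} \<and> d dvd n}"
      using False that by (auto dest: dvd_imp_le intro: Nat.gr0I)
    then show ?thesis using False A[of n] B[of n] by simp
  qed (simp add: A0 B)
  have "n \<le> N \<Longrightarrow> fps_nth F n = of_int (fps_nth P n)" for n
  proof (induction n rule: less_induct)
    case (less n)
    show ?case
    proof (cases "n = 0")
      case False
      have "of_nat n * fps_nth F n = (\<Sum>i<n. fps_nth F i * fps_nth A (n - i))"
        using F(1) A0 by (rule log_derivative_coeff_recursion)
      also have "\<dots> = of_int (\<Sum>i<n. fps_nth P i * fps_nth B (n - i))"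
        using less AB by (simp add: of_int_sum)
      also have "\<dots> = of_int (of_nat n * fps_nth P n)"
        using log_derivative_coeff_recursion[OF P(2), of n] B[of 0] by simp
      finally have "of_nat n * fps_nth F n = of_nat n * of_int (fps_nth P n)" by simp
      then show ?thesis using False by simp
    qed (use F P in simp)
  qed
  then show ?thesis by (metis Ints_of_int order_refl)
qed

lemma subgroup_count_eq_divisor_sum:
  assumes "\<forall>n\<ge>1. Delta_coeff G n \<in> \<int>"
  shows "\<exists>\<beta> :: nat \<Rightarrow> int. \<forall>n>0. int (subgroup_count G n) = (\<Sum>d | d dvd n. int d * \<beta> d)"
proof -
  define \<beta> where "\<beta> = (\<lambda>d. \<lfloor>Delta_coeff G d\<rfloor>)"
  have \<beta>: "Delta_coeff G d = of_int (\<beta> d)" if "d > 0" for d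
    using assms that by (auto simp: \<beta>_def elim!: Ints_cases)
  have "int (subgroup_count G n) = (\<Sum>d | d dvd n. int d * \<beta> d)" if n: "n > 0" for n
  proof -
    have "dirichlet_mult (Delta_coeff G) (dirichlet_shift riemann_zeta_coeff) n = dirichlet_shift (group_zeta_coeff G) n"
      unfolding Delta_coeff_def
      by (rule dirichlet_mult_divide) (use n in \<open>auto simp: dirichlet_shift_def riemann_zeta_coeff_def\<close>)
    then have "of_nat (subgroup_count G n) = of_nat n * (\<Sum>d | d dvd n. Delta_coeff G d * (1 / of_nat (n div d)))"
      using n by (simp add: dirichlet_mult_def dirichlet_shift_def riemann_zeta_coeff_def group_zeta_coeff_def field_simps)
    also have "\<dots> = (\<Sum>d | d dvd n. of_int (int d * \<beta> d))"
      unfolding sum_distrib_left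
    proof (rule sum.cong[OF refl])
      fix d assume "d \<in> {d. d dvd n}"
      then obtain e where e: "n = d * e" by (auto elim: dvdE)
      then have "d > 0" "e > 0" using n by auto
      then show "of_nat n * (Delta_coeff G d * (1 / of_nat (n div d))) = (of_int (int d * \<beta> d) :: rat)"
        using \<beta>[of d] by (simp add: e)
    qed
    also have "\<dots> = of_int (\<Sum>d | d dvd n. int d * \<beta> d)" by simp
    finally have "rat_of_int (int (subgroup_count G n)) = of_int (\<Sum>d | d dvd n. int d * \<beta> d)" by simp
    then show ?thesis by (simp only: of_int_eq_iff)
  qed
  then show ?thesis by blast
qed

section \<open>Periodic points of the full shift\<close>

text \<open>The shift by \<open>h\<close> reads the letter at \<open>inv h \<otimes> g\<close>, so a
  configuration is fixed by \<open>L\<close> exactly if it is constant on the cosets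
  \<open>L #> g\<close>: one letter is chosen freely per coset.\<close>

lemma (in group) fixed_point_count_full_shift:
  fixes A :: "'c set"
  assumes L: "subgroup L G" "finite (rcosets L)"
  shows "fixed_point_count (configurations G A) (full_shift G A) L = card A ^ subgroup_index G L"
proof -
  define F where "F = (\<lambda>y. \<lambda>g\<in>carrier G. y (L #> g) :: 'c)"
  define Y where "Y = (rcosets L \<rightarrow>\<^sub>E A)"
  have cos: "L #> g \<in> rcosets L" if "g \<in> carrier G" for g using that by (auto simp: RCOSETS_def)
  have shift: "L #> (inv h \<otimes> g) = L #> g" if "h \<in> L" "g \<in> carrier G" for h g
  proof -
    have "h \<in> carrier G" using that L by (simp add: subgroup.mem_carrier)
    then have "L #> (inv h \<otimes> g) = (L #> inv h) #> g"
      using that L by (simp add: coset_mult_assoc subgroup.subset)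
    also have "L #> inv h = L" using that L \<open>h \<in> carrier G\<close> by (simp add: coset_join2 subgroup.m_inv_closed)
    finally show ?thesis .
  qed
  have "inj_on F Y"
  proof (rule inj_onI)
    fix y y' assume y: "y \<in> Y" "y' \<in> Y" "F y = F y'"
    show "y = y'"
    proof (rule PiE_ext[OF y(1,2)[unfolded Y_def]])
      fix D assume "D \<in> rcosets L"
      then obtain g where "g \<in> carrier G" "D = L #> g" by (auto simp: RCOSETS_def)
      then show "y D = y' D" using fun_cong[OF y(3), of g] by (simp add: F_def)
    qed
  qed
  moreover have "F ` Y = {x \<in> configurations G A. \<forall>h\<in>L. full_shift G A h x = x}"
  proof
    show "F ` Y \<subseteq> {x \<in> configurations G A. \<forall>h\<in>L. full_shift G A h x = x}"
    proof (rule image_subsetI)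
      fix y assume y: "y \<in> Y"
      then have conf: "F y \<in> configurations G A"
        using cos by (auto simp: F_def Y_def configurations_def)
      have "full_shift G A h (F y) = F y" if h: "h \<in> L" for h
      proof
        fix g
        have "h \<in> carrier G" using h L by (simp add: subgroup.mem_carrier)
        then show "full_shift G A h (F y) g = F y g"
          using conf shift[OF h, of g] by (cases "g \<in> carrier G") (auto simp: full_shift_def F_def)
      qed
      with conf show "F y \<in> {x \<in> configurations G A. \<forall>h\<in>L. full_shift G A h x = x}" by auto
    qed
    show "{x \<in> configurations G A. \<forall>h\<in>L. full_shift G A h x = x} \<subseteq> F ` Y"
    proof
      fix x assume "x \<in> {x \<in> configurations G A. \<forall>h\<in>L. full_shift G A h x = x}"
      then have x: "x \<in> configurations G A" "\<And>h. h \<in> L \<Longrightarrow> full_shift G A h x = x" by auto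
      have inv: "x (inv h \<otimes> g) = x g" if "h \<in> L" "g \<in> carrier G" for h g
        using fun_cong[OF x(2)[OF that(1)], of g] that x(1) by (simp add: full_shift_def)
      define r where "r = (\<lambda>D. SOME g. g \<in> carrier G \<and> D = L #> g)"
      have r: "r D \<in> carrier G \<and> D = L #> r D" if "D \<in> rcosets L" for D
      proof -
        have "\<exists>g. g \<in> carrier G \<and> D = L #> g" using that by (auto simp: RCOSETS_def)
        then show ?thesis unfolding r_def by (rule someI_ex)
      qed
      have xr: "x (r (L #> g)) = x g" if g: "g \<in> carrier G" for g
      proof -
        have "r (L #> g) \<in> carrier G" "L #> g = L #> r (L #> g)" using r[OF cos[OF g]] by auto
        then have "r (L #> g) \<in> L #> g" using L by (metis rcos_self)
        then obtain h where h: "h \<in> L" "r (L #> g) = h \<otimes> g" by (auto simp: r_coset_def)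
        then show ?thesis using inv[of "inv h" g] g L by (simp add: subgroup.m_inv_closed subgroup.mem_carrier)
      qed
      define y where "y = (\<lambda>D\<in>rcosets L. x (r D))"
      have "y \<in> Y" using x(1) r by (auto simp: y_def Y_def configurations_def)
      moreover have "F y = x"
      proof
        fix g
        show "F y g = x g"
          using x(1) xr cos
          by (cases "g \<in> carrier G") (auto simp: F_def y_def configurations_def PiE_iff extensional_def)
      qed
      ultimately show "x \<in> F ` Y" by blast
    qed
  qed
  ultimately have "card Y = fixed_point_count (configurations G A) (full_shift G A) L"
    unfolding fixed_point_count_def by (metis card_image)
  then show ?thesis using L by (simp add: Y_def card_PiE subgroup_index_def)
qed

section \<open>Convergence in the disc and natural boundaries\<close>

lemma fps_conv_radius_polynomial_growth:
  fixes F :: "complex fps"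
  assumes "(\<lambda>n. norm (fps_nth F n)) \<in> O(\<lambda>n. real n ^ k)"
  shows "fps_conv_radius F \<ge> 1"
  unfolding fps_conv_radius_def
proof (rule conv_radius_geI_ex')
  fix r :: real assume r: "0 < r" "ereal r < 1"
  obtain C where C: "eventually (\<lambda>n. norm (fps_nth F n) \<le> C * real n ^ k) at_top"
    using assms by (auto elim!: landau_o.bigE)
  have "(\<lambda>n. (real (Suc n) / real (Suc (Suc n))) ^ k) \<longlonglongrightarrow> 1 ^ k"
    by (intro tendsto_power) real_asymp
  then have "conv_radius (\<lambda>n. real (Suc n) ^ k) = ereal 1"
    by (intro conv_radius_ratio_limit_nonzero[of _ 1]) (auto simp: power_divide norm_power)
  then have "summable (\<lambda>n. real (Suc n) ^ k * r ^ n)"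
    using r by (intro summable_in_conv_radius) auto
  then have "summable (\<lambda>n. C * (real (Suc n) ^ k * r ^ n))" by (rule summable_mult)
  then show "summable (\<lambda>n. fps_nth F n * of_real r ^ n)"
  proof (rule summable_comparison_test_ev[rotated])
    show "eventually (\<lambda>n. norm (fps_nth F n * of_real r ^ n) \<le> C * (real (Suc n) ^ k * r ^ n)) sequentially"
      using C eventually_gt_at_top[of 0]
    proof eventually_elim
      case (elim n)
      have "0 \<le> C * real n ^ k" using elim(1) norm_ge_zero order_trans by blast
      moreover have "real n ^ k > 0" using elim(2) by simp
      ultimately have "C \<ge> 0" by (metis mult_neg_pos not_less)
      then have "C * real n ^ k \<le> C * real (Suc n) ^ k" by (intro mult_left_mono power_mono) auto
      then have "norm (fps_nth F n) * r ^ n \<le> C * real (Suc n) ^ k * r ^ n"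
        using elim(1) r by (intro mult_right_mono) auto
      then show ?case using r by (simp add: norm_mult norm_power mult.assoc)
    qed
  qed
qed

text \<open>The exponential of a function holomorphic in the disc is holomorphic there, so its
  expansion, the formal composition, converges. As a value of \<open>exp\<close> it has no zeros,
  which the bound on logarithmic derivatives requires.\<close>

lemma fps_exp_compose_in_disc:
  fixes h :: "complex fps"
  assumes "fps_nth h 0 = 0" "fps_conv_radius h \<ge> 1"
  shows "fps_conv_radius (fps_exp 1 oo h) \<ge> 1"
    and "norm z < 1 \<Longrightarrow> eval_fps (fps_exp 1 oo h) z = exp (eval_fps h z)"
proof -
  have "exp has_fps_expansion (fps_exp 1 :: complex fps)" by (rule has_fps_expansion_exp1)
  moreover have "eval_fps h has_fps_expansion h"
    using assms(2) by (intro eval_fps_has_fps_expansion) (auto intro: less_le_trans[of _ "1::ereal"])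
  ultimately have ex: "(exp \<circ> eval_fps h) has_fps_expansion (fps_exp 1 oo h)"
    using assms(1) by (rule has_fps_expansion_compose)
  have hol: "(exp \<circ> eval_fps h) holomorphic_on ball 0 1"
    unfolding o_def using assms(2) by (intro holomorphic_intros) (auto simp: in_eball_iff less_le_trans[of _ "1::ereal"])
  then have "(exp \<circ> eval_fps h) holomorphic_on eball 0 (ereal 1)" by simp
  from holomorphic_on_imp_fps_conv_radius_ge[OF ex this] show "fps_conv_radius (fps_exp 1 oo h) \<ge> 1"
    by (simp add: one_ereal_def)
  show "eval_fps (fps_exp 1 oo h) z = exp (eval_fps h z)" if "norm z < 1"
    using has_fps_expansion_imp_eval_fps_eq[OF ex that hol] by simp
qed

lemma not_continues_analytically_if_log_derivative_unbounded:
  fixes F A :: "complex fps"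
  assumes R: "fps_conv_radius F \<ge> 1" and nz: "\<And>z. norm z < 1 \<Longrightarrow> eval_fps F z \<noteq> 0"
    and int: "\<And>n. fps_nth F n \<in> \<int>" and FA: "fps_X * fps_deriv F = F * A"
    and unb: "\<And>C. \<exists>n. norm (fps_nth A n) > C" and w: "norm w = 1"
  shows "\<not> continues_analytically_across F 1 w"
proof
  assume cont: "continues_analytically_across F 1 w"
  have "\<forall>n. \<exists>m. fps_nth F n = of_int m" using int by (auto elim: Ints_cases)
  then obtain c where c: "\<And>n. fps_nth F n = of_int (c n)" by metis
  then have F: "F = Abs_fps (\<lambda>n. of_int (c n))" by (simp add: fps_eq_iff)
  obtain q N i0 where q: "i0 < N" "q i0 \<noteq> 0" "\<And>j. (\<Sum>i<N. q i * c (i + j)) = 0"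
    using Polya_Carlson[of c w] R w cont unfolding F by blast
  have "(\<Sum>i<N. of_int (q i) * fps_nth F (i + j)) = 0" for j
    using arg_cong[OF q(3)[of j], of "of_int :: int \<Rightarrow> complex"] by (simp add: c)
  then obtain P Q where "Q \<noteq> 0" "fps_of_poly Q * F = fps_of_poly P"
    using rational_of_linear_relations[of i0 N "\<lambda>i. of_int (q i)" F] q by auto
  then obtain C where "\<forall>n. norm (fps_nth A n) \<le> C"
    using bounded_log_derivative_rational[OF R nz FA] by blast
  then show False using unb[of C] by (meson not_less)
qed

text \<open>Used contrapositively: if some point of the circle admits no continuation, the radius of
  convergence is not larger.\<close>

lemma continues_analytically_across_interior:
  assumes "ereal R < fps_conv_radius F" "norm w = R"
  shows "continues_analytically_across F R w"
proof -
  obtain r where r: "ereal R < ereal r" "ereal r < fps_conv_radius F"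
    using ereal_dense2[OF assms(1)] by blast
  have "ball w (r - R) \<subseteq> eball 0 (fps_conv_radius F)"
  proof
    fix z assume "z \<in> ball w (r - R)"
    then have "norm z < r" using assms(2) norm_triangle_ineq2[of z w] by (simp add: dist_norm norm_minus_commute)
    then show "z \<in> eball 0 (fps_conv_radius F)" using r(2) by (simp add: in_eball_iff less_trans[of _ "ereal r"])
  qed
  then show ?thesis
    unfolding continues_analytically_across_def using r
    by (intro exI[of _ "r - R"] conjI exI[of _ "eval_fps F"] holomorphic_intros) auto
qed

text \<open>Here \<open>G(z) = F(q z)\<close>. The boundary is established on the unit circle, where
  the integrality argument lives, and transported to radius \<open>1 / q\<close>.\<close>

lemma has_natural_boundary_rescale:
  fixes F :: "complex fps" and q :: real
  assumes q: "q > 0" and "has_natural_boundary F 1" and G: "\<And>n. fps_nth G n = fps_nth F n * of_real q ^ n"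
  shows "has_natural_boundary G (inverse q)"
  unfolding has_natural_boundary_def
proof (intro conjI ballI notI)
  have R: "fps_conv_radius F = 1" and nc: "\<And>w. norm w = 1 \<Longrightarrow> \<not> continues_analytically_across F 1 w"
    using assms(2) by (auto simp: has_natural_boundary_def one_ereal_def)
  show "inverse q > 0" using q by simp
  have "fps_conv_radius G = conv_radius (\<lambda>n. fps_nth F n * of_real q ^ n)"
    unfolding fps_conv_radius_def G ..
  also have "\<dots> = 1 / ereal q"
    using q R unfolding fps_conv_radius_def by (subst conv_radius_mult_power_right) auto
  finally show "fps_conv_radius G = ereal (inverse q)" using q by (simp add: one_ereal_def inverse_eq_divide)
  have ev: "eval_fps G z = eval_fps F (of_real q * z)" for z
    unfolding eval_fps_def G by (simp add: power_mult_distrib mult.assoc)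
  fix w assume w: "w \<in> sphere 0 (inverse q)" and "continues_analytically_across G (inverse q) w"
  then obtain e f where e: "e > 0" and f: "f holomorphic_on ball w e"
    and eq: "\<And>z. z \<in> ball w e \<inter> ball 0 (inverse q) \<Longrightarrow> f z = eval_fps G z"
    unfolding continues_analytically_across_def by blast
  have sc: "z / of_real q \<in> ball w e" if "z \<in> ball (of_real q * w) (q * e)" for z
  proof -
    have "q * dist w (z / of_real q) = norm (of_real q * (w - z / of_real q))"
      using q by (simp add: dist_norm norm_mult)
    also have "of_real q * (w - z / of_real q) = of_real q * w - z" using q by (simp add: right_diff_distrib)
    also have "norm (of_real q * w - z) < q * e" using that by (simp add: dist_norm)
    finally show ?thesis using q by simp
  qed
  have "continues_analytically_across F 1 (of_real q * w)"
    unfolding continues_analytically_across_def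
  proof (intro exI conjI ballI)
    show "q * e > 0" using q e by simp
    show "(\<lambda>z. f (z / of_real q)) holomorphic_on ball (of_real q * w) (q * e)"
      using q sc by (intro holomorphic_on_compose_gen[OF _ f, unfolded o_def] holomorphic_intros) auto
    fix z assume z: "z \<in> ball (of_real q * w) (q * e) \<inter> ball 0 1"
    then have "z / of_real q \<in> ball w e \<inter> ball 0 (inverse q)"
      using sc q by (auto simp: norm_divide field_simps)
    then show "f (z / of_real q) = eval_fps F z" using eq ev q by simp
  qed
  moreover have "norm (of_real q * w) = 1" using w q by (simp add: norm_mult)
  ultimately show False using nc by blast
qed

lemma (in group) dynamical_zeta_full_shift:
  fixes A :: "'c set"
  shows
  "dynamical_zeta G (configurations G A) (full_shift G A) =
     fps_exp 1 oo Abs_fps (\<lambda>n. of_nat (subgroup_count G n) * of_nat (card A) ^ n / of_nat n)"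
proof -
  have "(\<Sum>L\<in>subgroups_of_index G n. of_nat (fixed_point_count (configurations G A) (full_shift G A) L) /
           of_nat (subgroup_index G L)) = of_nat (subgroup_count G n) * of_nat (card A) ^ n / (of_nat n :: complex)" for n
  proof -
    have "(\<Sum>L\<in>subgroups_of_index G n. of_nat (fixed_point_count (configurations G A) (full_shift G A) L) /
           of_nat (subgroup_index G L)) = (\<Sum>L\<in>subgroups_of_index G n. of_nat (card A) ^ n / (of_nat n :: complex))"
    proof (rule sum.cong[OF refl])
      fix L assume "L \<in> subgroups_of_index G n"
      then have L: "subgroup L G" "finite (rcosets L)" "subgroup_index G L = n"
        by (auto simp: subgroups_of_index_def finite_index_subgroups_def)
      show "of_nat (fixed_point_count (configurations G A) (full_shift G A) L) / of_nat (subgroup_index G L) =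
          of_nat (card A) ^ n / (of_nat n :: complex)"
        unfolding fixed_point_count_full_shift[OF L(1,2)] L(3) by simp
    qed
    then show ?thesis by (simp add: subgroup_count_def)
  qed
  then show ?thesis by (simp add: dynamical_zeta_def)
qed

theorem theorem1p2:
  fixes G :: "('g, 'm) monoid_scheme" and A :: "'a set" and m :: nat
  assumes "group G"
    and "polycyclic_by_finite G"
    and "polynomial_subgroup_growth G"
    and "\<forall>n\<ge>1. Delta_coeff G n \<in> \<int>"
    and "has_hirsch_length G m"
    and "m \<ge> 2"
    and "finite A"
    and "A \<noteq> {}"
  shows "has_natural_boundary (dynamical_zeta G (configurations G A) (full_shift G A))
           (inverse (real (card A)))"
proof -
  interpret group G by fact
  define q where "q = real (card A)"
  have q: "q > 0" using assms(7,8) by (simp add: q_def card_gt_0_iff)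
  \<comment> \<open>The value 0 at index 0 gives \<open>D\<close> a vanishing constant term. In
    \<open>h\<close> this makes no difference, as the entry at 0 is divided by
    \<open>of_nat 0\<close>.\<close>
  define a where "a = (\<lambda>n. if n = 0 then 0 else subgroup_count G n)"
  \<comment> \<open>The parameter takes the values \<open>q\<close>, for the zeta function itself,
    and 1, for the series with integer coefficients.\<close>
  define h where "h = (\<lambda>s :: complex. Abs_fps (\<lambda>n. of_nat (a n) * s ^ n / of_nat n))"
  define F where "F = (\<lambda>s. fps_exp 1 oo h s)"
  define D where "D = (\<lambda>s :: complex. Abs_fps (\<lambda>n. of_nat (a n) * s ^ n))"
  have FD: "fps_X * fps_deriv (F s) = F s * D s" and F0: "fps_nth (F s) 0 = 1" for s
  proof -
    have "fps_X * fps_deriv (h s) = D s"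
      by (rule fps_ext) (auto simp: h_def D_def a_def split: nat.split)
    then show "fps_X * fps_deriv (F s) = F s * D s"
      using fps_log_derivative_exp[of "h s"] by (simp add: F_def h_def)
    show "fps_nth (F s) 0 = 1" by (simp add: F_def)
  qed
  have zeta: "dynamical_zeta G (configurations G A) (full_shift G A) = F (of_real q)"
    unfolding dynamical_zeta_full_shift F_def h_def
    by (rule arg_cong[of _ _ "fps_compose (fps_exp 1)"]) (auto simp: fps_eq_iff a_def q_def)
  \<comment> \<open>Both sides obey the recursion given by the logarithmic derivative, whose terms
    are homogeneous of degree \<open>n\<close> in \<open>q\<close>.\<close>
  have scale: "fps_nth (F (of_real q)) n = fps_nth (F 1) n * of_real q ^ n" for n
  proof (induction n rule: less_induct)
    case (less n)
    show ?case
    proof (cases "n = 0")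
      case False
      have "of_nat n * fps_nth (F (of_real q)) n = (\<Sum>i<n. fps_nth (F (of_real q)) i * fps_nth (D (of_real q)) (n - i))"
        by (rule log_derivative_coeff_recursion[OF FD]) (simp add: D_def a_def)
      also have "\<dots> = (\<Sum>i<n. fps_nth (F 1) i * fps_nth (D 1) (n - i)) * of_real q ^ n"
        unfolding sum_distrib_right
      proof (rule sum.cong[OF refl])
        fix i assume i: "i \<in> {..<n}"
        then have "of_real q ^ n = (of_real q ^ i * of_real q ^ (n - i) :: complex)" by (simp flip: power_add)
        then show "fps_nth (F (of_real q)) i * fps_nth (D (of_real q)) (n - i) =
            fps_nth (F 1) i * fps_nth (D 1) (n - i) * of_real q ^ n"
          using less i by (simp add: D_def)
      qed
      also have "(\<Sum>i<n. fps_nth (F 1) i * fps_nth (D 1) (n - i)) = of_nat n * fps_nth (F 1) n"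
        by (rule log_derivative_coeff_recursion[OF FD, symmetric]) (simp add: D_def a_def)
      finally show ?thesis using False by simp
    qed (simp add: F0)
  qed
  obtain k where k: "(\<lambda>n. real (subgroup_count G n)) \<in> O(\<lambda>n. real n ^ k)"
    using assms(3) unfolding polynomial_subgroup_growth_def by blast
  have h_R: "fps_conv_radius (h 1) \<ge> 1"
  proof (rule fps_conv_radius_polynomial_growth)
    have "(\<lambda>n. norm (fps_nth (h 1) n)) \<in> O(\<lambda>n. real (subgroup_count G n))"
      by (intro bigoI[of _ 1] always_eventually) (auto simp: h_def a_def norm_divide divide_le_eq mult_le_cancel_left1)
    also note k
    finally show "(\<lambda>n. norm (fps_nth (h 1) n)) \<in> O(\<lambda>n. real n ^ k)" .
  qed
  have h0: "fps_nth (h 1) 0 = 0" by (simp add: h_def)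
  have F1: "F 1 = fps_exp 1 oo h 1" by (simp add: F_def)
  note disc = fps_exp_compose_in_disc[OF h0 h_R, folded F1]
  obtain \<beta> :: "nat \<Rightarrow> int" where \<beta>: "\<And>n. n > 0 \<Longrightarrow> int (subgroup_count G n) = (\<Sum>d | d dvd n. int d * \<beta> d)"
    using subgroup_count_eq_divisor_sum[OF assms(4)] by blast
  have int: "fps_nth (F 1) n \<in> \<int>" for n
  proof (rule integer_coeffs_of_log_derivative[OF FD F0])
    show "fps_nth (D 1) n = of_int (\<Sum>d | d dvd n. int d * \<beta> d)" if "n > 0" for n
      using that unfolding \<beta>[OF that, symmetric] by (simp add: D_def a_def)
  qed (simp add: D_def a_def)
  have unb: "\<exists>n. norm (fps_nth (D 1) n) > C" for C
  proof -
    \<comment> \<open>The summand \<open>Suc (subgroup_count G 0)\<close> rules out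
      \<open>n = 0\<close>, where \<open>D\<close> was set to 0.\<close>
    obtain n where n: "Suc (subgroup_count G 0) + nat \<lceil>C\<rceil> < subgroup_count G n"
      using subgroup_count_unbounded[OF assms(5,6)] by blast
    then have "n \<noteq> 0" by (auto intro!: Nat.gr0I)
    then have "norm (fps_nth (D 1) n) = real (subgroup_count G n)" by (simp add: D_def a_def)
    moreover have "C < real (subgroup_count G n)" using n by linarith
    ultimately show ?thesis by metis
  qed
  have nc: "\<not> continues_analytically_across (F 1) 1 w" if "norm w = 1" for w
    using disc int unb that
    by (intro not_continues_analytically_if_log_derivative_unbounded[OF _ _ _ FD]) auto
  have "\<not> 1 < fps_conv_radius (F 1)"
    using continues_analytically_across_interior[of 1 "F 1" 1] nc[of 1] by (auto simp: one_ereal_def)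
  then have "has_natural_boundary (F 1) 1"
    using disc(1) nc by (auto simp: has_natural_boundary_def one_ereal_def)
  from has_natural_boundary_rescale[OF q this scale] show ?thesis
    unfolding zeta q_def .
qed

end
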